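(* Let $P(\alpha,\beta)=\sum_{i=0}^k\alpha^i\beta^{k-i}B_i\in\mathbb{C}[\alpha,\beta]_k^{n\times n}$ be a regular homogeneous matrix polynomial and let $A\in GL(2,\mathbb{C})$. Let $(\alpha_0,\beta_0)$ be a simple eigenvalue of $P(\alpha,\beta)$ and let $\langle A^{-1}[\alpha_0,\beta_0]^T\rangle$ be the eigenvalue of $M_A(P)(\gamma,\delta)$ associated with $(\alpha_0,\beta_0)$. Let $$Q_\theta^p:=\frac{\kappa_\theta^p(\langle A^{-1}[\alpha_0,\beta_0]^T\rangle,M_A(P))}{\kappa_\theta^p((\alpha_0,\beta_0),P)}$$ and let $Z_k:=4(k+1)^2\binom{k}{\lfloor k/2\rfloor}$. 1. If $k=1$, then $$\frac{1}{4\,\mathrm{cond}_\infty(A)}\le Q_\theta^p\le 4\,\mathrm{cond}_\infty(A).$$ 2. If $k\ge 2$, then $$\frac{1}{Z_k\,\mathrm{cond}_\infty(A)^{k-1}}\le Q_\theta^p\le Z_k\,\mathrm{cond}_\infty(A)^{k-1}.$$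
   Context: $\mathbb{C}[\alpha,\beta]_k^{m\times n}$ is the space of homogeneous matrix polynomials $P(\alpha,\beta)=\sum_{i=0}^k\alpha^i\beta^{k-i}B_i$ with $B_i\in\mathbb{C}^{m\times n}$ (including the zero polynomial). For $m=n$, $P$ is regular if $\det P(\alpha,\beta)\not\equiv 0$. An eigenvalue of a regular $P$ is a line $(\alpha_0,\beta_0)=\langle[\alpha_0,\beta_0]^T\rangle$ through the origin in $\mathbb{C}^2$ spanned by a nonzero vector $[\alpha_0,\beta_0]^T$ with $\det P(\alpha_0,\beta_0)=0$; any such nonzero vector on the line is a representative. It is simple if its algebraic multiplicity (as a root of the homogeneous polynomial $\det P(\alpha,\beta)$) is 1. Nonzero vectors $x,y$ with $P(\alpha_0,\beta_0)x=0$, $y^*P(\alpha_0,\beta_0)=0$ are right and left eigenvectors. $\langle v\rangle$ denotes the line spanned by $v$. For $A=\begin{bmatrix}a&b\\c&d\end{bmatrix}\in GL(2,\mathbb{C})$ (nonsingular $2\times2$ complex matrices), the Möbius transform of $P$ is $M_A(P)(\gamma,\delta)=\sum_{i=0}^k(a\gamma+b\delta)^i(c\gamma+d\delta)^{k-i}B_i=\sum_{i=0}^k\gamma^i\delta^{k-i}\widetilde B_i$. If $P$ is regular, so is $M_A(P)$; if $(\alpha_0,\beta_0)$ is a simple eigenvalue of $P$, then $\langle A^{-1}[\alpha_0,\beta_0]^T\rangle$ is a simple eigenvalue of $M_A(P)$ with the same right and left eigenvectors, called the eigenvalue of $M_A(P)$ associated with $(\alpha_0,\beta_0)$. Stewart–Sun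 eigenvalue condition number. For nonnegative weights $\omega_i$, $\kappa_\theta((\alpha_0,\beta_0),P)$ is the limit as $\epsilon\to0$ of the supremum of $\chi((\alpha_0,\beta_0),(\alpha_0+\Delta\alpha_0,\beta_0+\Delta\beta_0))/\epsilon$ over perturbed eigenpairs, $[(P+\Delta P)(\alpha_0+\Delta\alpha_0,\beta_0+\Delta\beta_0)](x+\Delta x)=0$, $\Delta P=\sum_i\alpha^i\beta^{k-i}\Delta B_i$ with $\|\Delta B_i\|_2\le\epsilon\,\omega_i$, where $\chi$ is the chordal distance (sine of the angle between lines). It is given (known formula, which may be taken as the definition, independent of the representative and eigenvectors chosen) by $$\kappa_\theta((\alpha_0,\beta_0),P)=\Big(\sum_{i=0}^k|\alpha_0|^i|\beta_0|^{k-i}\omega_i\Big)\frac{\|y\|_2\|x\|_2}{|y^*(\overline{\beta_0}D_\alpha P(\alpha_0,\beta_0)-\overline{\alpha_0}D_\beta P(\alpha_0,\beta_0))x|},$$ with $x,y$ right and left eigenvectors and $D_\alpha,D_\beta$ partial derivatives. $\kappa_\theta^p$ denotes the choice $\omega_i=\max_{j=0:k}\|B_j\|_2$ for all $i$; for $M_A(P)$, accordingly, the weights are $\max_{j=0:k}\|\widetilde B_j\|_2$ for all $i$. $\|\cdot\|_2$ is the Euclidean/spectral norm, $\|A\|_\infty$ the maximum absolute row sum, and $\mathrm{cond}_\infty(A)=\|A\|_\infty\|A^{-1}\|_\infty$. *)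

theory Defs
  imports
    "HOL-Analysis.Analysis"
    "HOL-Computational_Algebra.Polynomial"
begin

text \<open>
  A homogeneous matrix polynomial of grade k is given by k and its coefficients
  B 0, ..., B k; the values B i for i > k are never used.  A pair (alpha, beta) is a vector
  v :: complex^2 with alpha = v $ 1 and beta = v $ 2.
\<close>

definition hmp_eval :: "nat \<Rightarrow> (nat \<Rightarrow> complex^'n^'n) \<Rightarrow> complex \<Rightarrow> complex \<Rightarrow> complex^'n^'n" where
  "hmp_eval k B \<alpha> \<beta> = (\<chi> r c. \<Sum>i\<le>k. \<alpha> ^ i * \<beta> ^ (k - i) * B i $ r $ c)"

text \<open>
  The same object as a matrix over the bivariate polynomial ring: in complex poly poly the outer
  indeterminate is alpha and the inner one is beta.
\<close>

definition hmp_poly :: "nat \<Rightarrow> (nat \<Rightarrow> complex^'n^'n) \<Rightarrow> complex poly poly^'n^'n" where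
  "hmp_poly k B = (\<chi> r c. \<Sum>i\<le>k. monom (monom (B i $ r $ c) (k - i)) i)"

definition hmp_regular :: "nat \<Rightarrow> (nat \<Rightarrow> complex^'n^'n) \<Rightarrow> bool" where
  "hmp_regular k B \<longleftrightarrow> det (hmp_poly k B) \<noteq> 0"

definition line :: "complex^2 \<Rightarrow> (complex^2) set" where
  "line v = vec.span {v}"

definition representative :: "(complex^2) set \<Rightarrow> complex^2 \<Rightarrow> bool" where
  "representative L v \<longleftrightarrow> v \<noteq> 0 \<and> L = line v"

definition hmp_eigenvalue :: "nat \<Rightarrow> (nat \<Rightarrow> complex^'n^'n) \<Rightarrow> (complex^2) set \<Rightarrow> bool" where
  "hmp_eigenvalue k B L \<longleftrightarrow>
     (\<exists>v. representative L v \<and> det (hmp_eval k B (v $ 1) (v $ 2)) = 0)"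

text \<open>
  The multiplicity of the line spanned by v as a root of the homogeneous polynomial det P is the
  exponent of the linear form (v $ 2) * alpha - (v $ 1) * beta in det P (compare order_def for
  univariate polynomials).
\<close>

definition alg_mult :: "nat \<Rightarrow> (nat \<Rightarrow> complex^'n^'n) \<Rightarrow> complex^2 \<Rightarrow> nat" where
  "alg_mult k B v = (LEAST m. \<not> [: [:0, - (v $ 1):], [:v $ 2:] :] ^ Suc m dvd det (hmp_poly k B))"

definition simple_eigenvalue :: "nat \<Rightarrow> (nat \<Rightarrow> complex^'n^'n) \<Rightarrow> (complex^2) set \<Rightarrow> bool" where
  "simple_eigenvalue k B L \<longleftrightarrow>
     hmp_eigenvalue k B L \<and> (\<forall>v. representative L v \<longrightarrow> alg_mult k B v = 1)"

definition vcnj :: "complex^'n \<Rightarrow> complex^'n" where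
  "vcnj y = (\<chi> i. cnj (y $ i))"

definition right_eigenvector ::
  "nat \<Rightarrow> (nat \<Rightarrow> complex^'n^'n) \<Rightarrow> complex^2 \<Rightarrow> complex^'n \<Rightarrow> bool" where
  "right_eigenvector k B v x \<longleftrightarrow> x \<noteq> 0 \<and> hmp_eval k B (v $ 1) (v $ 2) *v x = 0"

definition left_eigenvector ::
  "nat \<Rightarrow> (nat \<Rightarrow> complex^'n^'n) \<Rightarrow> complex^2 \<Rightarrow> complex^'n \<Rightarrow> bool" where
  "left_eigenvector k B v y \<longleftrightarrow> y \<noteq> 0 \<and> vcnj y v* hmp_eval k B (v $ 1) (v $ 2) = 0"

text \<open>
  Coefficients of the Moebius transform: the coefficient of gamma^l delta^(k - l) in
  (a gamma + b delta)^i (c gamma + d delta)^(k - i) is read off after setting delta = 1.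
  The lemma below the definition is the defining identity of the transform.
\<close>

definition moebius :: "complex^2^2 \<Rightarrow> nat \<Rightarrow> (nat \<Rightarrow> complex^'n^'n) \<Rightarrow> nat \<Rightarrow> complex^'n^'n" where
  "moebius A k B l = (\<chi> r c. \<Sum>i\<le>k.
     coeff ([:A $ 1 $ 2, A $ 1 $ 1:] ^ i * [:A $ 2 $ 2, A $ 2 $ 1:] ^ (k - i)) l * B i $ r $ c)"

lemma homogenize_mult_linear:
  fixes p :: "complex poly"
  assumes "degree p \<le> m"
  shows "(\<Sum>l\<le>Suc m. coeff ([:b, a:] * p) l * (g ^ l * d ^ (Suc m - l))) =
         (a * g + b * d) * (\<Sum>l\<le>m. coeff p l * (g ^ l * d ^ (m - l)))"
proof -
  have 0: "coeff p (Suc m) = 0"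
    using assms by (simp add: coeff_eq_0)
  have "(\<Sum>l\<le>Suc m. coeff ([:b, a:] * p) l * (g ^ l * d ^ (Suc m - l))) =
        (\<Sum>l\<le>Suc m. b * coeff p l * (g ^ l * d ^ (Suc m - l))) +
        (\<Sum>l\<le>Suc m. coeff (pCons 0 (smult a p)) l * (g ^ l * d ^ (Suc m - l)))"
    by (simp add: sum.distrib[symmetric] algebra_simps del: sum.atMost_Suc)
  also have "(\<Sum>l\<le>Suc m. b * coeff p l * (g ^ l * d ^ (Suc m - l))) =
        (\<Sum>l\<le>m. b * coeff p l * (g ^ l * d ^ (Suc m - l)))"
    using 0 by simp
  also have "\<dots> = b * d * (\<Sum>l\<le>m. coeff p l * (g ^ l * d ^ (m - l)))"
    by (simp add: sum_distrib_left Suc_diff_le algebra_simps)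
  also have "(\<Sum>l\<le>Suc m. coeff (pCons 0 (smult a p)) l * (g ^ l * d ^ (Suc m - l))) =
        a * g * (\<Sum>l\<le>m. coeff p l * (g ^ l * d ^ (m - l)))"
    by (subst sum.atMost_Suc_shift) (simp add: sum_distrib_left algebra_simps)
  finally show ?thesis
    by (simp add: algebra_simps)
qed

lemma homogenize_linear_powers:
  fixes a b c e :: complex
  shows "(\<Sum>l\<le>i + j. coeff ([:b, a:] ^ i * [:e, c:] ^ j) l * (g ^ l * d ^ (i + j - l))) =
         (a * g + b * d) ^ i * (c * g + e * d) ^ j"
proof -
  have lin: "degree [:u, w:] \<le> 1" for u w :: complex
    by simp
  have deg: "degree ([:u, w:] ^ j) \<le> j" for u w :: complex and j
    using degree_power_le[of "[:u, w:]" j] lin[of u w] by (metis le_trans mult.commute mult_le_mono2 nat_mult_1_right)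
  have deg2: "degree ([:b, a:] ^ i * [:e, c:] ^ j) \<le> i + j" for i j
    by (rule order_trans[OF degree_mult_le]) (intro add_mono deg)
  have base: "(\<Sum>l\<le>j. coeff ([:e, c:] ^ j) l * (g ^ l * d ^ (j - l))) = (c * g + e * d) ^ j" for j
  proof (induction j)
    case (Suc j)
    show ?case
      unfolding power_Suc homogenize_mult_linear[OF deg] Suc ..
  qed simp
  show ?thesis
  proof (induction i)
    case 0
    then show ?case by (simp add: base)
  next
    case (Suc i)
    show ?case
      using homogenize_mult_linear[OF deg2, of b a i j g d] Suc
      by (simp add: mult.assoc del: sum.atMost_Suc mult_pCons_left)
  qed
qed

lemma hmp_eval_moebius:
  "hmp_eval k (moebius A k B) \<gamma> \<delta> =
   hmp_eval k B (A $ 1 $ 1 * \<gamma> + A $ 1 $ 2 * \<delta>) (A $ 2 $ 1 * \<gamma> + A $ 2 $ 2 * \<delta>)"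
proof -
  define h where "h i = [:A $ 1 $ 2, A $ 1 $ 1:] ^ i * [:A $ 2 $ 2, A $ 2 $ 1:] ^ (k - i)" for i
  have h: "(\<Sum>l\<le>k. coeff (h i) l * (\<gamma> ^ l * \<delta> ^ (k - l))) =
      (A $ 1 $ 1 * \<gamma> + A $ 1 $ 2 * \<delta>) ^ i * (A $ 2 $ 1 * \<gamma> + A $ 2 $ 2 * \<delta>) ^ (k - i)"
    if "i \<le> k" for i
    using homogenize_linear_powers[where i = i and j = "k - i"] that by (simp add: h_def)
  have "(\<Sum>l\<le>k. \<gamma> ^ l * \<delta> ^ (k - l) * (\<Sum>i\<le>k. coeff (h i) l * B i $ r $ c)) =
        (\<Sum>i\<le>k. (\<Sum>l\<le>k. coeff (h i) l * (\<gamma> ^ l * \<delta> ^ (k - l))) * B i $ r $ c)" for r c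
    unfolding sum_distrib_left sum_distrib_right
    by (subst sum.swap) (simp add: mult_ac)
  then show ?thesis
    by (simp add: hmp_eval_def moebius_def vec_eq_iff h flip: h_def)
qed

definition hmp_D\<alpha> :: "nat \<Rightarrow> (nat \<Rightarrow> complex^'n^'n) \<Rightarrow> complex \<Rightarrow> complex \<Rightarrow> complex^'n^'n" where
  "hmp_D\<alpha> k B \<alpha> \<beta> = (\<chi> r c. deriv (\<lambda>t. hmp_eval k B t \<beta> $ r $ c) \<alpha>)"

definition hmp_D\<beta> :: "nat \<Rightarrow> (nat \<Rightarrow> complex^'n^'n) \<Rightarrow> complex \<Rightarrow> complex \<Rightarrow> complex^'n^'n" where
  "hmp_D\<beta> k B \<alpha> \<beta> = (\<chi> r c. deriv (\<lambda>t. hmp_eval k B \<alpha> t $ r $ c) \<beta>)"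

text \<open>
  The Stewart-Sun condition number by its explicit formula, for a representative v of the
  eigenvalue and right and left eigenvectors x, y.  For a simple eigenvalue of a regular polynomial
  the value does not depend on v, x, y, and kappa_theta is this common value.
\<close>

definition kappa_formula ::
  "(nat \<Rightarrow> real) \<Rightarrow> nat \<Rightarrow> (nat \<Rightarrow> complex^'n^'n) \<Rightarrow> complex^2 \<Rightarrow> complex^'n \<Rightarrow> complex^'n \<Rightarrow> real" where
  "kappa_formula \<omega> k B v x y =
     (let \<alpha> = v $ 1; \<beta> = v $ 2;
          M = mat (cnj \<beta>) ** hmp_D\<alpha> k B \<alpha> \<beta> - mat (cnj \<alpha>) ** hmp_D\<beta> k B \<alpha> \<beta>
      in (\<Sum>i\<le>k. cmod \<alpha> ^ i * cmod \<beta> ^ (k - i) * \<omega> i) *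
         (norm y * norm x / cmod (\<Sum>r\<in>UNIV. cnj (y $ r) * (M *v x) $ r)))"

definition kappa_theta ::
  "(nat \<Rightarrow> real) \<Rightarrow> nat \<Rightarrow> (nat \<Rightarrow> complex^'n^'n) \<Rightarrow> (complex^2) set \<Rightarrow> real" where
  "kappa_theta \<omega> k B L =
     (THE \<kappa>. \<exists>v x y. representative L v \<and> right_eigenvector k B v x \<and> left_eigenvector k B v y \<and>
        \<kappa> = kappa_formula \<omega> k B v x y)"

text \<open>The library norm on matrices is the Frobenius norm, hence onorm for the spectral norm.\<close>

definition spectral_norm :: "complex^'n^'n \<Rightarrow> real" where
  "spectral_norm M = onorm (\<lambda>x. M *v x)"

definition kappa_theta_p :: "nat \<Rightarrow> (nat \<Rightarrow> complex^'n^'n) \<Rightarrow> (complex^2) set \<Rightarrow> real" where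
  "kappa_theta_p k B L = kappa_theta (\<lambda>i. Max ((\<lambda>j. spectral_norm (B j)) ` {..k})) k B L"

definition norm_inf :: "complex^'n^'n \<Rightarrow> real" where
  "norm_inf M = Max (range (\<lambda>r. \<Sum>c\<in>UNIV. cmod (M $ r $ c)))"

definition cond_inf :: "complex^'n^'n \<Rightarrow> real" where
  "cond_inf A = norm_inf A * norm_inf (matrix_inv A)"

definition Q_theta_p :: "complex^2^2 \<Rightarrow> nat \<Rightarrow> (nat \<Rightarrow> complex^'n^'n) \<Rightarrow> complex^2 \<Rightarrow> real" where
  "Q_theta_p A k B v =
     kappa_theta_p k (moebius A k B) (line (matrix_inv A *v v)) / kappa_theta_p k B (line v)"

definition Z_const :: "nat \<Rightarrow> real" where
  "Z_const k = 4 * (real k + 1)\<^sup>2 * real (k choose (k div 2))"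

end

theory Submission
  imports Defs
begin

text \<open>
  Fix eigenvectors x, y of P at v and consider the scalar form y^* P x, which vanishes at v.  By
  Euler's identity its derivative at v in the direction h is s (h1 v2 - h2 v1) for some scalar s, so
  the denominator of the Stewart-Sun formula is |s| |v|^2.  Under the Moebius transform, with
  v = A w, the chain rule multiplies s by det A.  The eigenvectors therefore cancel in the quotient Q,
  which becomes an expression in |v|, |w|, |det A| and the two maximal coefficient norms.  It is
  bounded using 1 / |det A| \<le> 2 |A^-1| / |A|; for k = 1 the sharper bound of the coefficients by
  the column sums of A, which are |det A| times the row sums of A^-1, is needed.  The lower
  bound is the upper bound for A^-1 and the transformed polynomial.

  All of this requires s to be nonzero and the eigenvectors to be unique up to scaling.  If s = 0,
  replacing a column of P by P x and then a row by y^* P gives a matrix with determinant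
  a nonzero constant times det P, whose replaced row and column are divisible by the linear form
  vanishing at v, and whose crossing entry is divisible by its square; hence v is not simple.
  Uniqueness follows, since in an eigenspace of dimension at least two the linear condition s = 0
  has a nonzero solution.
\<close>

section \<open>Determinants divisible by a square\<close>

text \<open>The new row i is the combination of all rows of A with coefficients
  \<open>y $ r\<close>. By linearity in row i only the multiple of row i itself survives, since
  every other summand has two equal rows.\<close>

lemma det_replace_row:
  fixes A :: "'a::comm_ring_1^'n^'n"
  shows "det (\<chi> r. if r = i then y v* A else A $ r) = y $ i * det A"
proof -
  have sum: "y v* A = (\<Sum>r\<in>UNIV. y $ r *s A $ r)"
    by (simp add: vec_eq_iff vector_matrix_mult_def mult.commute)
  have row: "(\<chi> r. if r = i then A $ i else A $ r) = A"
    by (simp add: vec_eq_iff)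
  have "det (\<chi> r. if r = i then A $ j else A $ r) = 0" if "j \<noteq> i" for j
    using that by (intro det_identical_rows[of j i]) (auto simp: row_def vec_eq_iff)
  then have "y $ j * det (\<chi> r. if r = i then A $ j else A $ r) = (if j = i then y $ i * det A else 0)" for j
    using row by auto
  then show ?thesis
    unfolding sum det_linear_row_sum[OF finite] det_row_mul by simp
qed

lemma det_replace_column:
  fixes A :: "'a::comm_ring_1^'n^'n"
  shows "det (\<chi> r c. if c = j then (A *v x) $ r else A $ r $ c) = x $ j * det A"
proof -
  have "transpose (\<chi> r c. if c = j then (A *v x) $ r else A $ r $ c) =
        (\<chi> r. if r = j then x v* transpose A else transpose A $ r)"
    by (auto simp: vec_eq_iff transpose_def vector_matrix_mult_def matrix_vector_mult_def mult.commute)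
  then show ?thesis
    using det_replace_row[of j x "transpose A"]
    by (simp only: det_transpose flip: det_transpose[of "\<chi> r c. if c = j then (A *v x) $ r else A $ r $ c"])
qed

text \<open>Each product of the Leibniz expansion either contains the crossing entry, or meets row i
  and column j in two different factors, each divisible by l.\<close>

lemma square_dvd_det_cross:
  fixes A :: "'a::comm_ring_1^'n^'n"
  assumes row: "\<And>c. l dvd A $ i $ c" and col: "\<And>r. l dvd A $ r $ j" and "l\<^sup>2 dvd A $ i $ j"
  shows "l\<^sup>2 dvd det A"
  unfolding det_def
proof (intro dvd_sum dvd_mult)
  fix p :: "'n \<Rightarrow> 'n"
  assume "p \<in> {p. p permutes UNIV}"
  then have "bij p" by (simp add: permutes_bij)
  show "l\<^sup>2 dvd (\<Prod>r\<in>UNIV. A $ r $ p r)"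
  proof (cases "p i = j")
    case True
    have "A $ i $ p i dvd (\<Prod>r\<in>UNIV. A $ r $ p r)"
      by (rule dvd_prodI) simp_all
    with True show ?thesis using assms(3) dvd_trans by metis
  next
    case False
    obtain m where m: "p m = j" using \<open>bij p\<close> by (metis bij_pointE)
    with False have "m \<noteq> i" by auto
    have "l * l dvd A $ i $ p i * A $ m $ p m"
      using row col m by (intro mult_dvd_mono) auto
    also have "A $ i $ p i * A $ m $ p m = (\<Prod>r\<in>{i, m}. A $ r $ p r)"
      using \<open>m \<noteq> i\<close> by simp
    also have "\<dots> dvd (\<Prod>r\<in>UNIV. A $ r $ p r)"
      by (rule prod_dvd_prod_subset) auto
    finally show ?thesis by (simp add: power2_eq_square)
  qed
qed

text \<open>Replacing column j by A x and then row i by the y-combination of the rows multiplies the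
  determinant by the unit \<open>y $ i * x $ j\<close>. The resulting matrix has the cross pattern
  of \<open>square_dvd_det_cross\<close>.\<close>

lemma square_dvd_det:
  fixes A :: "'a::comm_ring_1^'n^'n"
  assumes row: "\<And>c. l dvd (y v* A) $ c" and col: "\<And>r. l dvd (A *v x) $ r"
    and "l\<^sup>2 dvd (\<Sum>r\<in>UNIV. y $ r * (A *v x) $ r)"
    and unit: "y $ i dvd 1" "x $ j dvd 1"
  shows "l\<^sup>2 dvd det A"
proof -
  define A1 where "A1 = (\<chi> r c. if c = j then (A *v x) $ r else A $ r $ c)"
  define A2 where "A2 = (\<chi> r. if r = i then y v* A1 else A1 $ r)"
  \<comment> \<open>Left multiplication by y acts on each column separately, so only column j
    differs from \<open>y v* A\<close>; there the entry is y^T A x.\<close>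
  have A1: "y v* A1 = (\<chi> c. if c = j then \<Sum>r\<in>UNIV. y $ r * (A *v x) $ r else (y v* A) $ c)"
    by (auto simp: vec_eq_iff vector_matrix_mult_def A1_def mult.commute)
  have "l dvd (y v* A1) $ c" for c
  proof (cases "c = j")
    case True
    then show ?thesis using col by (auto simp: A1 intro!: dvd_sum dvd_mult)
  qed (simp add: A1 row)
  moreover have "l dvd A2 $ r $ j" for r
    using col calculation by (simp add: A2_def A1_def)
  moreover have "l\<^sup>2 dvd A2 $ i $ j"
    using assms(3) by (simp add: A2_def A1)
  ultimately have "l\<^sup>2 dvd det A2"
    by (intro square_dvd_det_cross[where i = i and j = j]) (simp_all add: A2_def)
  also have "det A2 = y $ i * x $ j * det A"
    by (simp add: A2_def A1_def det_replace_row det_replace_column mult.assoc)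
  finally have dvd: "l\<^sup>2 dvd y $ i * x $ j * det A" .
  obtain u where "y $ i * x $ j * u = 1"
    using mult_dvd_mono[OF unit] by (metis dvdE mult_1)
  then have "det A = u * (y $ i * x $ j * det A)"
    by (metis mult.commute mult.left_commute mult_1)
  then show ?thesis
    using dvd dvd_mult by metis
qed

section \<open>Binary forms as bivariate polynomials\<close>

definition hform :: "nat \<Rightarrow> (nat \<Rightarrow> complex) \<Rightarrow> complex poly poly" where
  "hform k c = (\<Sum>i\<le>k. monom (monom (c i) (k - i)) i)"

text \<open>The form v_2 \<alpha> - v_1 \<beta>, which vanishes on the line of v; its powers are the
  divisors in \<open>alg_mult\<close>.\<close>

definition linear_form :: "complex^2 \<Rightarrow> complex poly poly" where
  "linear_form v = [: [:0, - (v $ 1):], [:v $ 2:] :]"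

lemma sum_monom: "(\<Sum>i\<in>I. monom (f i) n) = monom (\<Sum>i\<in>I. f i) n"
  by (simp add: poly_eq_iff coeff_sum)

lemma root_factor:
  assumes "v $ 2 \<noteq> 0"
  shows "[:- monom (v $ 1 / v $ 2) (Suc 0), 1:] = [:[:1 / v $ 2:]:] * linear_form v"
  using assms by (simp add: linear_form_def monom_altdef)

text \<open>For nonzero v_2 the linear form is a unit times the monic factor of the root \<alpha> =
  (v_1 / v_2) \<beta>. This makes the univariate root criteria over the ring of polynomials in
  \<beta> available.\<close>

lemma linear_form_dvd_iff:
  assumes "v $ 2 \<noteq> 0"
  shows "linear_form v ^ m dvd p \<longleftrightarrow> [:- monom (v $ 1 / v $ 2) (Suc 0), 1:] ^ m dvd p"
proof -
  have "is_unit ([:[:1 / v $ 2:]:] ^ m :: complex poly poly)"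
    using assms by (intro dvdI[of _ _ "[:[:v $ 2:]:] ^ m"]) (simp add: flip: power_mult_distrib one_pCons)
  then show ?thesis
    unfolding root_factor[OF assms] power_mult_distrib by (simp add: mult_unit_dvd_iff')
qed

text \<open>By homogeneity, the substitution \<alpha> = \<rho> \<beta> turns every monomial into a
  multiple of \<beta>^k.\<close>

lemma poly_hform:
  "poly (hform k c) (monom \<rho> (Suc 0)) = monom (\<Sum>i\<le>k. c i * \<rho> ^ i) k"
  unfolding hform_def sum_monom[symmetric]
  by (auto simp: poly_sum poly_monom monom_power mult_monom intro!: sum.cong)

lemma pderiv_sum: "pderiv (sum f I) = (\<Sum>i\<in>I. pderiv (f i))"
  by (induction I rule: infinite_finite_induct) (simp_all add: pderiv_add)

lemma poly_pderiv_hform: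
  "poly (pderiv (hform k c)) (monom \<rho> (Suc 0)) = monom (\<Sum>i\<le>k. of_nat i * c i * \<rho> ^ (i - 1)) (k - 1)"
proof -
  \<comment> \<open>For i = 0 both sides vanish through the factor \<open>of_nat i\<close>;
    otherwise the exponents k - i and i - 1 add up to k - 1.\<close>
  have "of_nat i * monom (c i) (k - i) * monom \<rho> (Suc 0) ^ (i - 1) =
      monom (of_nat i * c i * \<rho> ^ (i - 1)) (k - 1)" if "i \<le> k" for i
    using that by (cases "i = 0")
      (auto simp: monom_power mult_monom of_nat_poly mult.assoc simp flip: smult_monom)
  then show ?thesis
    unfolding sum_monom[symmetric]
    by (simp add: hform_def poly_sum poly_monom pderiv_sum pderiv_monom)
qed

lemma homogeneous_sum_eq:
  fixes v :: "complex^2"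
  assumes "v $ 2 \<noteq> 0"
  shows "(\<Sum>i\<le>k. v $ 1 ^ i * v $ 2 ^ (k - i) * c i) = v $ 2 ^ k * (\<Sum>i\<le>k. c i * (v $ 1 / v $ 2) ^ i)"
  unfolding sum_distrib_left
  using assms by (intro sum.cong refl) (simp add: power_divide power_diff field_simps)

lemma linear_form_dvd_hform:
  assumes "v \<noteq> 0" and "(\<Sum>i\<le>k. v $ 1 ^ i * v $ 2 ^ (k - i) * c i) = 0"
  shows "linear_form v dvd hform k c"
proof (cases "v $ 2 = 0")
  case False
  then have "poly (hform k c) (monom (v $ 1 / v $ 2) (Suc 0)) = 0"
    using assms(2) by (simp add: poly_hform homogeneous_sum_eq)
  then show ?thesis
    using linear_form_dvd_iff[OF False, of 1] by (simp add: poly_eq_0_iff_dvd)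
next
  \<comment> \<open>The linear form is now - v_1 \<beta>, a constant for the outer indeterminate, so
    divisibility is tested coefficientwise. Only the coefficient of \<alpha>^k lacks a factor
    \<beta>, and it is 0 because it is the only term left in the value at v.\<close>
  case True
  then have "v $ 1 \<noteq> 0"
    using assms(1) by (simp add: vec_eq_iff forall_2)
  have "(\<Sum>i\<le>k. v $ 1 ^ i * v $ 2 ^ (k - i) * c i) = (\<Sum>i\<in>{k}. v $ 1 ^ i * v $ 2 ^ (k - i) * c i)"
    using True by (intro sum.mono_neutral_right) auto
  then have "c k = 0"
    using assms(2) \<open>v $ 1 \<noteq> 0\<close> by simp
  then have "[:0, - (v $ 1):] dvd monom (c i) (k - i)" if "i \<le> k" for i
    using that \<open>v $ 1 \<noteq> 0\<close> 
    by (cases "i = k") (auto intro!: dvdI[of _ _ "monom (- (c i / v $ 1)) (k - i - 1)"]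
        simp: smult_monom Suc_diff_Suc simp flip: monom_Suc)
  then show ?thesis
    using True unfolding hform_def linear_form_def
    by (intro dvd_sum) (auto simp: const_poly_dvd_iff)
qed

lemma square_dvd_double_root:
  fixes p :: "'a::idom poly"
  assumes "poly p a = 0" "poly (pderiv p) a = 0"
  shows "[:- a, 1:]\<^sup>2 dvd p"
proof -
  obtain q where q: "p = [:- a, 1:] * q"
    using assms(1) by (metis poly_eq_0_iff_dvd dvdE)
  have "pderiv p = q + [:- a, 1:] * pderiv q"
    unfolding q pderiv_mult by (simp add: pderiv_pCons)
  then have "poly q a = 0" using assms(2) by simp
  then show ?thesis
    using q by (metis poly_eq_0_iff_dvd power2_eq_square mult_dvd_mono dvd_refl)
qed

text \<open>A form that vanishes at v together with both partial derivatives has a double root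
  there. For nonzero v_2 the \<alpha>-derivative shows this; for v_2 = 0 the \<beta>-derivative
  does.\<close>

lemma linear_form_square_dvd_hform:
  assumes "v \<noteq> 0" "k \<ge> 1"
    and 0: "(\<Sum>i\<le>k. v $ 1 ^ i * v $ 2 ^ (k - i) * c i) = 0"
    and \<alpha>: "(\<Sum>i\<le>k. of_nat i * v $ 1 ^ (i - 1) * v $ 2 ^ (k - i) * c i) = 0"
    and \<beta>: "(\<Sum>i\<le>k. of_nat (k - i) * v $ 1 ^ i * v $ 2 ^ (k - i - 1) * c i) = 0"
  shows "(linear_form v)\<^sup>2 dvd hform k c"
proof (cases "v $ 2 = 0")
  case False
  have "(\<Sum>i\<le>k. of_nat i * v $ 1 ^ (i - 1) * v $ 2 ^ (k - i) * c i) =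
      v $ 2 ^ (k - 1) * (\<Sum>i\<le>k. of_nat i * c i * (v $ 1 / v $ 2) ^ (i - 1))"
    unfolding sum_distrib_left
  proof (intro sum.cong refl)
    fix i assume "i \<in> {..k}"
    show "of_nat i * v $ 1 ^ (i - 1) * v $ 2 ^ (k - i) * c i =
        v $ 2 ^ (k - 1) * (of_nat i * c i * (v $ 1 / v $ 2) ^ (i - 1))"
    proof (cases i)
      case (Suc j)
      with \<open>i \<in> {..k}\<close> have "v $ 2 ^ (k - 1) = v $ 2 ^ (k - i) * v $ 2 ^ j"
        by (simp flip: power_add)
      with Suc False show ?thesis by (simp add: power_divide)
    qed simp
  qed
  then have "poly (pderiv (hform k c)) (monom (v $ 1 / v $ 2) (Suc 0)) = 0"
    using \<alpha> False by (simp add: poly_pderiv_hform)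
  moreover have "poly (hform k c) (monom (v $ 1 / v $ 2) (Suc 0)) = 0"
    using False 0 by (simp add: poly_hform homogeneous_sum_eq)
  ultimately show ?thesis
    using linear_form_dvd_iff[OF False, of 2] by (simp add: square_dvd_double_root)
next
  case True
  then have v1: "v $ 1 \<noteq> 0"
    using assms(1) by (simp add: vec_eq_iff forall_2)
  have "(\<Sum>i\<le>k. v $ 1 ^ i * v $ 2 ^ (k - i) * c i) = (\<Sum>i\<in>{k}. v $ 1 ^ i * v $ 2 ^ (k - i) * c i)"
    using True by (intro sum.mono_neutral_right) auto
  then have ck: "c k = 0"
    using 0 v1 by simp
  \<comment> \<open>With v_2 = 0 only i = k - 1 remains: at i = k the truncated exponent is also 0,
    but the factor \<open>of_nat (k - i)\<close> vanishes.\<close>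
  have "(\<Sum>i\<le>k. of_nat (k - i) * v $ 1 ^ i * v $ 2 ^ (k - i - 1) * c i) =
      (\<Sum>i\<in>{k - 1}. of_nat (k - i) * v $ 1 ^ i * v $ 2 ^ (k - i - 1) * c i)"
    using True \<open>k \<ge> 1\<close> by (intro sum.mono_neutral_right) auto
  then have ck': "c (k - 1) = 0"
    using \<beta> v1 \<open>k \<ge> 1\<close> by simp
  have "[:0, - (v $ 1):]\<^sup>2 dvd monom (c i) (k - i)" if "i \<le> k" for i
  proof (cases "i = k \<or> i = k - 1")
    case False
    define m where "m = k - i - 2"
    have m: "k - i = m + 2" using False that unfolding m_def by arith
    have "[:0, - (v $ 1):] = monom (- (v $ 1)) 1" by (simp add: monom_altdef)
    with m v1 show ?thesis
      by (auto intro!: dvdI[of _ _ "monom (c i / (v $ 1)\<^sup>2) m"] simp: monom_power mult_monom)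
  qed (use ck ck' in auto)
  then show ?thesis
    using True unfolding hform_def linear_form_def
    by (intro dvd_sum) (auto simp: const_poly_dvd_iff poly_const_pow)
qed

section \<open>Values and derivatives of binary forms\<close>

text \<open>Bilinear, without conjugation, so that it makes sense over the polynomial ring as well;
  y^* M x is \<open>bform (vcnj y) M x\<close>.\<close>

definition bform :: "'a::comm_ring_1^'n \<Rightarrow> 'a^'n^'n \<Rightarrow> 'a^'n \<Rightarrow> 'a" where
  "bform y M x = (\<Sum>r\<in>UNIV. y $ r * (M *v x) $ r)"

lemma bform_expand: "bform y M x = (\<Sum>r\<in>UNIV. \<Sum>c\<in>UNIV. y $ r * M $ r $ c * x $ c)"
  by (simp add: bform_def matrix_vector_mult_def sum_distrib_left mult.assoc)

lemma bform_scale: "bform (b *s y) M (a *s x) = b * a * bform y M x"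
  by (simp add: bform_expand sum_distrib_left mult_ac)

lemma bform_linear_combination:
  assumes "\<And>r c. M $ r $ c = (\<Sum>i\<in>I. w i * B i $ r $ c)"
  shows "bform y M x = (\<Sum>i\<in>I. w i * bform y (B i) x)"
proof -
  have "bform y M x = (\<Sum>r\<in>UNIV. \<Sum>c\<in>UNIV. \<Sum>i\<in>I. y $ r * (w i * B i $ r $ c) * x $ c)"
    by (simp add: bform_expand assms sum_distrib_left sum_distrib_right mult.assoc)
  also have "\<dots> = (\<Sum>i\<in>I. \<Sum>r\<in>UNIV. \<Sum>c\<in>UNIV. y $ r * (w i * B i $ r $ c) * x $ c)"
    by (simp only: sum.swap[of _ I])
  finally show ?thesis
    by (simp add: bform_expand sum_distrib_left mult_ac)
qed

definition form_val :: "nat \<Rightarrow> (nat \<Rightarrow> complex) \<Rightarrow> complex^2 \<Rightarrow> complex" where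
  "form_val k b v = (\<Sum>i\<le>k. v $ 1 ^ i * v $ 2 ^ (k - i) * b i)"

definition form_D\<alpha> :: "nat \<Rightarrow> (nat \<Rightarrow> complex) \<Rightarrow> complex^2 \<Rightarrow> complex" where
  "form_D\<alpha> k b v = (\<Sum>i\<le>k. of_nat i * v $ 1 ^ (i - 1) * v $ 2 ^ (k - i) * b i)"

definition form_D\<beta> :: "nat \<Rightarrow> (nat \<Rightarrow> complex) \<Rightarrow> complex^2 \<Rightarrow> complex" where
  "form_D\<beta> k b v = (\<Sum>i\<le>k. of_nat (k - i) * v $ 1 ^ i * v $ 2 ^ (k - i - 1) * b i)"

text \<open>The derivative in the direction (cnj beta, - cnj alpha) of the Stewart-Sun formula.\<close>

definition form_D\<theta> :: "nat \<Rightarrow> (nat \<Rightarrow> complex) \<Rightarrow> complex^2 \<Rightarrow> complex" where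
  "form_D\<theta> k b v = cnj (v $ 2) * form_D\<alpha> k b v - cnj (v $ 1) * form_D\<beta> k b v"

lemma form_val_scale: "form_val k b (c *s v) = c ^ k * form_val k b v"
  unfolding form_val_def sum_distrib_left
proof (intro sum.cong refl)
  fix i assume "i \<in> {..k}"
  then have "c ^ k = c ^ i * c ^ (k - i)" by (simp flip: power_add)
  then show "(c *s v) $ 1 ^ i * (c *s v) $ 2 ^ (k - i) * b i = c ^ k * (v $ 1 ^ i * v $ 2 ^ (k - i) * b i)"
    by (simp add: power_mult_distrib)
qed

text \<open>Linearity in the coefficients. It makes the derivative linear in each eigenvector, which
  yields both the scaling behaviour and the uniqueness of eigenvectors.\<close>

lemma form_D\<theta>_add:
  "form_D\<theta> k (\<lambda>i. a * b i + a' * b' i) v = a * form_D\<theta> k b v + a' * form_D\<theta> k b' v"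
proof -
  have "form_D\<alpha> k (\<lambda>i. a * b i + a' * b' i) v = a * form_D\<alpha> k b v + a' * form_D\<alpha> k b' v"
    by (simp add: form_D\<alpha>_def sum_distrib_left ring_distribs mult_ac flip: sum.distrib)
  moreover have "form_D\<beta> k (\<lambda>i. a * b i + a' * b' i) v = a * form_D\<beta> k b v + a' * form_D\<beta> k b' v"
    by (simp add: form_D\<beta>_def sum_distrib_left ring_distribs mult_ac flip: sum.distrib del: of_nat_diff)
  ultimately show ?thesis
    by (simp add: form_D\<theta>_def algebra_simps)
qed

lemma form_val_has_derivative:
  "((\<lambda>t. form_val k b (v + t *s h)) has_field_derivative
     h $ 1 * form_D\<alpha> k b v + h $ 2 * form_D\<beta> k b v) (at 0)"
  unfolding form_val_def form_D\<alpha>_def form_D\<beta>_def sum_distrib_left sum.distrib[symmetric]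
  by (intro DERIV_sum) (auto intro!: derivative_eq_intros simp: algebra_simps)

text \<open>Both sides are the derivative at t = 0 of one function, computed once along w + t h and
  once along A w + t A h.\<close>

lemma form_D_chain:
  fixes A :: "complex^2^2"
  assumes "\<And>w. form_val k b' w = form_val k b (A *v w)"
  shows "h $ 1 * form_D\<alpha> k b' w + h $ 2 * form_D\<beta> k b' w =
    (A *v h) $ 1 * form_D\<alpha> k b (A *v w) + (A *v h) $ 2 * form_D\<beta> k b (A *v w)"
proof -
  have "form_val k b' (w + t *s h) = form_val k b (A *v w + t *s (A *v h))" for t
    by (simp add: assms matrix_vector_right_distrib vector_scalar_commute)
  then have "((\<lambda>t. form_val k b' (w + t *s h)) has_field_derivative
     (A *v h) $ 1 * form_D\<alpha> k b (A *v w) + (A *v h) $ 2 * form_D\<beta> k b (A *v w)) (at 0)"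
    by (simp add: form_val_has_derivative)
  with form_val_has_derivative show ?thesis
    by (rule DERIV_unique)
qed

lemma form_D_scale:
  assumes "k \<ge> 1"
  shows "form_D\<alpha> k b (c *s v) = c ^ (k - 1) * form_D\<alpha> k b v"
    "form_D\<beta> k b (c *s v) = c ^ (k - 1) * form_D\<beta> k b v"
proof -
  have "of_nat i * (c *s v) $ 1 ^ (i - 1) * (c *s v) $ 2 ^ (k - i) * b i =
      c ^ (k - 1) * (of_nat i * v $ 1 ^ (i - 1) * v $ 2 ^ (k - i) * b i)" if "i \<le> k" for i
  proof (cases i)
    case (Suc j)
    then have "c ^ (k - 1) = c ^ j * c ^ (k - i)"
      using that by (simp flip: power_add)
    with Suc show ?thesis by (simp add: power_mult_distrib)
  qed simp
  then show "form_D\<alpha> k b (c *s v) = c ^ (k - 1) * form_D\<alpha> k b v"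
    unfolding form_D\<alpha>_def sum_distrib_left by (intro sum.cong) simp_all
  have "of_nat (k - i) * (c *s v) $ 1 ^ i * (c *s v) $ 2 ^ (k - i - 1) * b i =
      c ^ (k - 1) * (of_nat (k - i) * v $ 1 ^ i * v $ 2 ^ (k - i - 1) * b i)" if "i \<le> k" for i
  proof (cases "k - i")
    case (Suc j)
    then have "k - 1 = i + j" using that by simp
    then have "c ^ (k - 1) = c ^ i * c ^ j"
      by (simp only: power_add)
    with Suc show ?thesis by (simp add: power_mult_distrib)
  qed simp
  then show "form_D\<beta> k b (c *s v) = c ^ (k - 1) * form_D\<beta> k b v"
    unfolding form_D\<beta>_def sum_distrib_left by (intro sum.cong) simp_all
qed

text \<open>The partial derivatives are homogeneous of degree k - 1 and the conjugated direction
  contributes \<open>cnj c\<close>, so degree k appears only after taking absolute values.\<close>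

lemma cmod_form_D\<theta>_scale:
  assumes "k \<ge> 1"
  shows "cmod (form_D\<theta> k b (c *s v)) = cmod c ^ k * cmod (form_D\<theta> k b v)"
proof -
  have "form_D\<theta> k b (c *s v) = cnj c * c ^ (k - 1) * form_D\<theta> k b v"
    by (simp add: form_D\<theta>_def form_D_scale[OF assms] algebra_simps)
  then show ?thesis
    using assms by (cases k) (simp_all add: norm_mult norm_power)
qed

lemma form_euler:
  "v $ 1 * form_D\<alpha> k b v + v $ 2 * form_D\<beta> k b v = of_nat k * form_val k b v"
  unfolding form_D\<alpha>_def form_D\<beta>_def form_val_def sum_distrib_left sum.distrib[symmetric]
proof (intro sum.cong refl)
  fix i assume "i \<in> {..k}"
  then have k: "of_nat k = of_nat i + (of_nat (k - i) :: complex)" by (simp flip: of_nat_add)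
  \<comment> \<open>Where the exponent i - 1 or k - i - 1 is truncated, the factor in front is
    0.\<close>
  have pow: "of_nat i * (v $ 1 * v $ 1 ^ (i - 1)) = of_nat i * v $ 1 ^ i"
    "of_nat (k - i) * (v $ 2 * v $ 2 ^ (k - i - 1)) = of_nat (k - i) * v $ 2 ^ (k - i)"
    by (simp_all add: power_eq_if del: of_nat_diff)
  have "v $ 1 * (of_nat i * v $ 1 ^ (i - 1) * v $ 2 ^ (k - i) * b i) +
      v $ 2 * (of_nat (k - i) * v $ 1 ^ i * v $ 2 ^ (k - i - 1) * b i) =
      of_nat i * (v $ 1 * v $ 1 ^ (i - 1)) * (v $ 2 ^ (k - i) * b i) +
      of_nat (k - i) * (v $ 2 * v $ 2 ^ (k - i - 1)) * (v $ 1 ^ i * b i)"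
    by (simp only: mult_ac)
  also have "\<dots> = of_nat k * (v $ 1 ^ i * v $ 2 ^ (k - i) * b i)"
    unfolding k pow by (simp only: ring_distribs mult_ac)
  finally show "v $ 1 * (of_nat i * v $ 1 ^ (i - 1) * v $ 2 ^ (k - i) * b i) +
         v $ 2 * (of_nat (k - i) * v $ 1 ^ i * v $ 2 ^ (k - i - 1) * b i) =
         of_nat k * (v $ 1 ^ i * v $ 2 ^ (k - i) * b i)" .
qed

definition norm_sq :: "complex^2 \<Rightarrow> real" where
  "norm_sq v = (cmod (v $ 1))\<^sup>2 + (cmod (v $ 2))\<^sup>2"

lemma norm_sq_complex: "of_real (norm_sq v) = v $ 1 * cnj (v $ 1) + v $ 2 * cnj (v $ 2)"
  by (simp add: norm_sq_def complex_norm_square del: of_real_power)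

lemma norm_sq_pos: "v \<noteq> 0 \<Longrightarrow> norm_sq v > 0"
  by (auto simp: norm_sq_def vec_eq_iff forall_2 sum_power2_gt_zero_iff)

text \<open>Euler's identity and the definition of \<open>form_D\<theta>\<close> are two linear
  equations for the partial derivatives, with determinant \<open>- norm_sq v\<close>. For nonzero v
  the gradient is therefore s (v_2, - v_1) with s =
  \<open>form_D\<theta> k b v / norm_sq v\<close>.\<close>

lemma form_D_eq:
  assumes "form_val k b v = 0"
  shows "form_D\<alpha> k b v * norm_sq v = v $ 2 * form_D\<theta> k b v"
    "form_D\<beta> k b v * norm_sq v = - (v $ 1 * form_D\<theta> k b v)"
proof -
  have "v $ 1 * form_D\<alpha> k b v + v $ 2 * form_D\<beta> k b v = 0"
    using form_euler[of v k b] assms by simp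
  then show "form_D\<alpha> k b v * norm_sq v = v $ 2 * form_D\<theta> k b v"
    "form_D\<beta> k b v * norm_sq v = - (v $ 1 * form_D\<theta> k b v)"
    unfolding norm_sq_complex form_D\<theta>_def by algebra+
qed

text \<open>The gradient at w is the transpose of A applied to the gradient at v, a multiple of
  (v_2, - v_1). Since v = A w, the alternating form h_1 v_2 - h_2 v_1 at A h equals det A times (h_1
  w_2 - h_2 w_1).\<close>

lemma form_D\<theta>_moebius:
  fixes A :: "complex^2^2"
  assumes "\<And>w. form_val k b' w = form_val k b (A *v w)" and v: "v = A *v w"
    and "form_val k b v = 0"
  shows "form_D\<theta> k b' w * norm_sq v = norm_sq w * det A * form_D\<theta> k b v"
proof -
  have chain: "h $ 1 * form_D\<alpha> k b' w + h $ 2 * form_D\<beta> k b' w =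
      (A *v h) $ 1 * form_D\<alpha> k b v + (A *v h) $ 2 * form_D\<beta> k b v" for h
    using form_D_chain[of k b' b A h w] assms by simp
  have \<alpha>: "form_D\<alpha> k b' w = A $ 1 $ 1 * form_D\<alpha> k b v + A $ 2 $ 1 * form_D\<beta> k b v"
    using chain[of "vector [1, 0]"] by (simp add: matrix_vector_mult_def sum_2)
  have \<beta>: "form_D\<beta> k b' w = A $ 1 $ 2 * form_D\<alpha> k b v + A $ 2 $ 2 * form_D\<beta> k b v"
    using chain[of "vector [0, 1]"] by (simp add: matrix_vector_mult_def sum_2)
  have w: "v $ 1 = A $ 1 $ 1 * w $ 1 + A $ 1 $ 2 * w $ 2" "v $ 2 = A $ 2 $ 1 * w $ 1 + A $ 2 $ 2 * w $ 2"
    unfolding v by (simp_all add: matrix_vector_mult_def sum_2)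
  have "form_D\<theta> k b' w = cnj (w $ 2) * (A $ 1 $ 1 * form_D\<alpha> k b v + A $ 2 $ 1 * form_D\<beta> k b v)
      - cnj (w $ 1) * (A $ 1 $ 2 * form_D\<alpha> k b v + A $ 2 $ 2 * form_D\<beta> k b v)"
    unfolding form_D\<theta>_def[of k b' w] \<alpha> \<beta> ..
  then have "form_D\<theta> k b' w * norm_sq v =
      cnj (w $ 2) * (A $ 1 $ 1 * (form_D\<alpha> k b v * norm_sq v) + A $ 2 $ 1 * (form_D\<beta> k b v * norm_sq v))
      - cnj (w $ 1) * (A $ 1 $ 2 * (form_D\<alpha> k b v * norm_sq v) + A $ 2 $ 2 * (form_D\<beta> k b v * norm_sq v))"
    by algebra
  also have "\<dots> = norm_sq w * det A * form_D\<theta> k b v"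
    unfolding form_D_eq[OF assms(3)] norm_sq_complex[of w] det_2 w by algebra
  finally show ?thesis .
qed

section \<open>Matrix polynomials through the scalar forms y^* P x\<close>

lemma bform_hmp_eval:
  "bform y (hmp_eval k B (v $ 1) (v $ 2)) x = form_val k (\<lambda>i. bform y (B i) x) v"
  unfolding form_val_def by (rule bform_linear_combination) (simp add: hmp_eval_def)

lemma hmp_D\<alpha>_nth:
  "hmp_D\<alpha> k B \<alpha> \<beta> $ r $ c = (\<Sum>i\<le>k. of_nat i * \<alpha> ^ (i - 1) * \<beta> ^ (k - i) * B i $ r $ c)"
  unfolding hmp_D\<alpha>_def hmp_eval_def vec_lambda_beta
  by (intro DERIV_imp_deriv DERIV_sum) (auto intro!: derivative_eq_intros)

lemma hmp_D\<beta>_nth: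
  "hmp_D\<beta> k B \<alpha> \<beta> $ r $ c = (\<Sum>i\<le>k. of_nat (k - i) * \<alpha> ^ i * \<beta> ^ (k - i - 1) * B i $ r $ c)"
  unfolding hmp_D\<beta>_def hmp_eval_def vec_lambda_beta
  by (intro DERIV_imp_deriv DERIV_sum) (auto intro!: derivative_eq_intros)

definition monomial_sum :: "nat \<Rightarrow> complex^2 \<Rightarrow> real" where
  "monomial_sum k v = (\<Sum>i\<le>k. cmod (v $ 1) ^ i * cmod (v $ 2) ^ (k - i))"

lemma monomial_sum_scale: "monomial_sum k (c *s v) = cmod c ^ k * monomial_sum k v"
  unfolding monomial_sum_def sum_distrib_left
proof (intro sum.cong refl)
  fix i assume "i \<in> {..k}"
  then have "cmod c ^ k = cmod c ^ i * cmod c ^ (k - i)" by (simp flip: power_add)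
  then show "cmod ((c *s v) $ 1) ^ i * cmod ((c *s v) $ 2) ^ (k - i) =
      cmod c ^ k * (cmod (v $ 1) ^ i * cmod (v $ 2) ^ (k - i))"
    by (simp add: power_mult_distrib norm_mult)
qed

lemma mat_mult_nth: "(mat c ** M) $ i $ j = c * M $ i $ j"
  by (simp add: matrix_matrix_mult_def mat_def if_distrib[where f = "\<lambda>z. z * _"] cong: if_cong)

text \<open>A constant weight factors out of the sum, and as y^* M x is linear in M, the denominator
  is the directional derivative of the form with coefficients y^* B_i x.\<close>

lemma kappa_formula_const:
  "kappa_formula (\<lambda>_. \<omega>) k B v x y =
     monomial_sum k v * \<omega> * (norm y * norm x / cmod (form_D\<theta> k (\<lambda>i. bform (vcnj y) (B i) x) v))"
proof -
  define M where "M = mat (cnj (v $ 2)) ** hmp_D\<alpha> k B (v $ 1) (v $ 2)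
    - mat (cnj (v $ 1)) ** hmp_D\<beta> k B (v $ 1) (v $ 2)"
  have "M $ r $ c = (\<Sum>i\<le>k. (cnj (v $ 2) * (of_nat i * v $ 1 ^ (i - 1) * v $ 2 ^ (k - i))
      - cnj (v $ 1) * (of_nat (k - i) * v $ 1 ^ i * v $ 2 ^ (k - i - 1))) * B i $ r $ c)" for r c
    by (simp add: M_def mat_mult_nth hmp_D\<alpha>_nth hmp_D\<beta>_nth sum_distrib_left
        left_diff_distrib mult.assoc sum_subtractf del: of_nat_diff)
  then have "bform (vcnj y) M x = (\<Sum>i\<le>k. (cnj (v $ 2) * (of_nat i * v $ 1 ^ (i - 1) * v $ 2 ^ (k - i))
      - cnj (v $ 1) * (of_nat (k - i) * v $ 1 ^ i * v $ 2 ^ (k - i - 1))) * bform (vcnj y) (B i) x)"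
    by (rule bform_linear_combination)
  also have "\<dots> = form_D\<theta> k (\<lambda>i. bform (vcnj y) (B i) x) v"
    by (simp add: form_D\<theta>_def form_D\<alpha>_def form_D\<beta>_def sum_distrib_left
        left_diff_distrib mult.assoc sum_subtractf del: of_nat_diff)
  finally show ?thesis
    by (simp add: kappa_formula_def Let_def bform_def vcnj_def monomial_sum_def sum_distrib_right flip: M_def)
qed

section \<open>Constant vectors and the matrix over the polynomial ring\<close>

definition vconst :: "complex^'n \<Rightarrow> complex poly poly^'n" where
  "vconst x = (\<chi> i. [:[:x $ i:]:])"

lemma hform_linear_combination:
  assumes "\<And>i. c i = (\<Sum>j\<in>J. w j * b j i)"
  shows "hform k c = (\<Sum>j\<in>J. [:[:w j:]:] * hform k (b j))"
  unfolding hform_def sum_distrib_left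
  by (subst sum.swap) (simp add: assms smult_monom flip: sum_monom)

lemma hmp_poly_nth: "hmp_poly k B $ r $ c = hform k (\<lambda>i. B i $ r $ c)"
  by (simp add: hmp_poly_def hform_def)

lemma hmp_poly_mult_vconst: "(hmp_poly k B *v vconst x) $ r = hform k (\<lambda>i. (B i *v x) $ r)"
  by (subst hform_linear_combination[where J = UNIV and w = "\<lambda>c. x $ c" and b = "\<lambda>c i. B i $ r $ c"])
    (simp_all add: matrix_vector_mult_def hmp_poly_nth vconst_def mult.commute)

lemma vconst_mult_hmp_poly: "(vconst y v* hmp_poly k B) $ c = hform k (\<lambda>i. (y v* B i) $ c)"
  by (subst hform_linear_combination[where J = UNIV and w = "\<lambda>r. y $ r" and b = "\<lambda>r i. B i $ r $ c"])
    (simp_all add: vector_matrix_mult_def hmp_poly_nth vconst_def mult.commute)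

lemma bform_hmp_poly: "bform (vconst y) (hmp_poly k B) (vconst x) = hform k (\<lambda>i. bform y (B i) x)"
  unfolding bform_def hmp_poly_mult_vconst
  by (subst hform_linear_combination[where J = UNIV and w = "\<lambda>r. y $ r" and b = "\<lambda>r i. (B i *v x) $ r"])
    (simp_all add: vconst_def)

text \<open>A zero derivative would make y^T P x divisible by the square of the linear form. The
  entries of P x and y^T P vanish at v and are divisible by the linear form itself, so
  \<open>square_dvd_det\<close> would apply.\<close>

lemma form_D\<theta>_nonzero:
  assumes "k \<ge> 1" "v \<noteq> 0" and sq: "\<not> (linear_form v)\<^sup>2 dvd det (hmp_poly k B)"
    and x: "x \<noteq> 0" "hmp_eval k B (v $ 1) (v $ 2) *v x = 0"
    and y: "y \<noteq> 0" "y v* hmp_eval k B (v $ 1) (v $ 2) = 0"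
  shows "form_D\<theta> k (\<lambda>i. bform y (B i) x) v \<noteq> 0"
proof
  define b where "b i = bform y (B i) x" for i
  assume D: "form_D\<theta> k (\<lambda>i. bform y (B i) x) v = 0"
  have val: "form_val k b v = 0"
    unfolding b_def bform_hmp_eval[symmetric] by (simp add: bform_def x)
  then have "form_D\<alpha> k b v = 0" "form_D\<beta> k b v = 0"
    using form_D_eq[OF val] D norm_sq_pos[OF \<open>v \<noteq> 0\<close>] by (simp_all add: b_def[abs_def])
  then have "(linear_form v)\<^sup>2 dvd hform k b"
    using linear_form_square_dvd_hform[OF assms(2,1)] val
    by (simp add: form_val_def form_D\<alpha>_def form_D\<beta>_def)
  then have sq': "(linear_form v)\<^sup>2 dvd bform (vconst y) (hmp_poly k B) (vconst x)"
    by (simp add: bform_hmp_poly b_def[abs_def])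
  have "linear_form v dvd (hmp_poly k B *v vconst x) $ r" for r
  proof -
    have "(\<Sum>i\<le>k. v $ 1 ^ i * v $ 2 ^ (k - i) * (B i *v x) $ r) = (hmp_eval k B (v $ 1) (v $ 2) *v x) $ r"
      by (simp add: hmp_eval_def matrix_vector_mult_def sum_distrib_left sum_distrib_right mult.assoc)
        (rule sum.swap)
    then show ?thesis
      unfolding hmp_poly_mult_vconst by (intro linear_form_dvd_hform \<open>v \<noteq> 0\<close>) (simp add: x)
  qed
  moreover have "linear_form v dvd (vconst y v* hmp_poly k B) $ c" for c
  proof -
    have "(\<Sum>i\<le>k. v $ 1 ^ i * v $ 2 ^ (k - i) * (y v* B i) $ c) = (y v* hmp_eval k B (v $ 1) (v $ 2)) $ c"
      by (simp add: hmp_eval_def vector_matrix_mult_def sum_distrib_left sum_distrib_right mult_ac)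
        (rule sum.swap)
    then show ?thesis
      unfolding vconst_mult_hmp_poly by (intro linear_form_dvd_hform \<open>v \<noteq> 0\<close>) (simp add: y)
  qed
  moreover obtain i j where "y $ i \<noteq> 0" "x $ j \<noteq> 0"
    using x y by (auto simp: vec_eq_iff)
  \<comment> \<open>A nonzero complex number is a unit of the polynomial ring, as
    \<open>square_dvd_det\<close> requires of one entry of each vector.\<close>
  moreover have "vconst z $ l dvd 1" if "z $ l \<noteq> 0" for z :: "complex^'n" and l
    using that by (intro dvdI[of _ _ "[:[:1 / z $ l:]:]"]) (simp add: vconst_def one_pCons)
  ultimately have "(linear_form v)\<^sup>2 dvd det (hmp_poly k B)"
    using sq' unfolding bform_def
    by (intro square_dvd_det[of "linear_form v" "vconst y" _ "vconst x" i j]) auto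
  with sq show False ..
qed

section \<open>Simple eigenvalues and the condition number\<close>

lemma line_eq: "line v = range (\<lambda>c. c *s v)"
  by (simp add: line_def vec.span_singleton)

lemma representative_line_iff:
  assumes "v \<noteq> 0"
  shows "representative (line v) u \<longleftrightarrow> (\<exists>c. c \<noteq> 0 \<and> u = c *s v)"
proof
  assume u: "representative (line v) u"
  have "u \<in> line u" by (simp add: line_def vec.span_base)
  with u obtain c where "u = c *s v"
    by (auto simp: representative_def line_eq)
  with u show "\<exists>c. c \<noteq> 0 \<and> u = c *s v"
    by (auto simp: representative_def)
next
  assume "\<exists>c. c \<noteq> 0 \<and> u = c *s v"
  then obtain c where c: "c \<noteq> 0" "u = c *s v" by blast
  have "a *s v \<in> line u" for a
    using c by (auto simp: line_eq vector_smult_assoc intro!: image_eqI[of _ _ "a / c"])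
  moreover have "a *s u \<in> line v" for a
    using c by (auto simp: line_eq vector_smult_assoc)
  ultimately show "representative (line v) u"
    using c assms by (auto simp: representative_def line_eq)
qed

text \<open>Ensures that the \<open>LEAST\<close> in \<open>alg_mult\<close> is attained. The
  multiplicity is bounded by the degree in \<alpha> if v_2 is nonzero, and otherwise by the degree
  in \<beta> of the leading coefficient.\<close>

lemma linear_form_power_not_dvd:
  assumes "v \<noteq> 0" "p \<noteq> 0"
  shows "\<exists>m. \<not> linear_form v ^ Suc m dvd p"
proof (cases "v $ 2 = 0")
  case False
  define m where "m = degree p"
  have "degree (linear_form v ^ Suc m) = Suc m"
    using False by (simp add: linear_form_def degree_power_eq del: power_Suc)
  then have "\<not> linear_form v ^ Suc m dvd p"
    using dvd_imp_degree_le[OF _ \<open>p \<noteq> 0\<close>, of "linear_form v ^ Suc m"] by (auto simp: m_def)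
  then show ?thesis ..
next
  case True
  with \<open>v \<noteq> 0\<close> have "v $ 1 \<noteq> 0" by (simp add: vec_eq_iff forall_2)
  define q where "q = lead_coeff p"
  define m where "m = degree q"
  have "degree ([:0, - (v $ 1):] ^ Suc m) = Suc m"
    using \<open>v $ 1 \<noteq> 0\<close> by (simp add: degree_power_eq del: power_Suc)
  then have "\<not> [:0, - (v $ 1):] ^ Suc m dvd q"
    using dvd_imp_degree_le[of "[:0, - (v $ 1):] ^ Suc m" q] \<open>p \<noteq> 0\<close> by (auto simp: m_def q_def)
  then have "\<not> linear_form v ^ Suc m dvd p"
    using True by (auto simp: linear_form_def poly_const_pow const_poly_dvd_iff q_def simp del: power_Suc)
  then show ?thesis ..
qed

text \<open>The least m is 1, and the exponent in \<open>alg_mult\<close> is \<open>Suc m\<close>,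
  hence the second power fails to divide.\<close>

lemma alg_mult_one:
  assumes "hmp_regular k B" "v \<noteq> 0" "alg_mult k B v = 1"
  shows "\<not> (linear_form v)\<^sup>2 dvd det (hmp_poly k B)"
proof -
  have "\<exists>m. \<not> linear_form v ^ Suc m dvd det (hmp_poly k B)"
    using assms by (intro linear_form_power_not_dvd) (auto simp: hmp_regular_def)
  from LeastI_ex[OF this] assms(3) show ?thesis
    by (simp add: alg_mult_def linear_form_def power2_eq_square)
qed

text \<open>The span of 0 contains no nonzero vector and thus has no representative.\<close>

lemma simple_eigenvalue_nonzero:
  assumes "simple_eigenvalue k B (line v)"
  shows "v \<noteq> 0"
proof
  assume "v = 0"
  obtain u where "u \<noteq> 0" "line v = line u"
    using assms by (auto simp: simple_eigenvalue_def hmp_eigenvalue_def representative_def)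
  moreover have "u \<in> line u" by (simp add: line_def vec.span_base)
  ultimately show False using \<open>v = 0\<close> by (auto simp: line_eq)
qed

lemma hmp_eval_scale:
  fixes v :: "complex^2"
  shows "hmp_eval k B ((c *s v) $ 1) ((c *s v) $ 2) = (\<chi> i j. c ^ k * hmp_eval k B (v $ 1) (v $ 2) $ i $ j)"
  using form_val_scale[of k "\<lambda>i. B i $ _ $ _"]
  by (simp add: vec_eq_iff hmp_eval_def form_val_def)

lemma scaled_matrix_kernel:
  fixes M :: "complex^'n^'n"
  assumes "a \<noteq> 0"
  shows "(\<chi> i j. a * M $ i $ j) *v x = 0 \<longleftrightarrow> M *v x = 0"
    "y v* (\<chi> i j. a * M $ i $ j) = 0 \<longleftrightarrow> y v* M = 0"
proof -
  have "(\<chi> i j. a * M $ i $ j) *v x = a *s (M *v x)"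
    by (simp add: vec_eq_iff matrix_vector_mult_def sum_distrib_left mult.assoc)
  then show "(\<chi> i j. a * M $ i $ j) *v x = 0 \<longleftrightarrow> M *v x = 0"
    using assms by simp
  have "y v* (\<chi> i j. a * M $ i $ j) = a *s (y v* M)"
    by (simp add: vec_eq_iff vector_matrix_mult_def sum_distrib_left mult_ac)
  then show "y v* (\<chi> i j. a * M $ i $ j) = 0 \<longleftrightarrow> y v* M = 0"
    using assms by simp
qed

lemma singular_null_vectors:
  fixes M :: "'a::field^'n^'n"
  assumes "det M = 0"
  obtains x y where "x \<noteq> 0" "M *v x = 0" "y \<noteq> 0" "y v* M = 0"
proof -
  have null: "\<exists>x. x \<noteq> 0 \<and> N *v x = 0" if "det N = 0" for N :: "'a^'n^'n"
    using that matrix_left_invertible_ker[of N] invertible_det_nz[of N] invertible_left_inverse[of N] by blast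
  obtain x where "x \<noteq> 0" "M *v x = 0" using null[OF assms] by blast
  moreover obtain y where "y \<noteq> 0" "transpose M *v y = 0" using null[of "transpose M"] assms by auto
  ultimately show ?thesis using that by (simp add: transpose_matrix_vector)
qed

lemma vcnj_vcnj [simp]: "vcnj (vcnj y) = y"
  by (simp add: vcnj_def vec_eq_iff)

lemma vcnj_scale: "vcnj (b *s y) = cnj b *s vcnj y"
  by (simp add: vcnj_def vec_eq_iff)

lemma vcnj_eq_0_iff [simp]: "vcnj y = 0 \<longleftrightarrow> y = 0"
  by (simp add: vcnj_def vec_eq_iff)

lemma norm_vscale: "norm (c *s (x :: complex^'n)) = cmod c * norm x"
  by (simp add: norm_vec_def norm_mult L2_set_right_distrib)

text \<open>Everything that makes \<open>kappa_theta\<close> well defined: eigenvectors exist, the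
  denominator is nonzero, and both eigenspaces are one-dimensional.\<close>

lemma simple_eigenvectors:
  assumes "hmp_regular k B" "k \<ge> 1" and simple: "simple_eigenvalue k B (line v)"
  obtains x y where "right_eigenvector k B v x" "left_eigenvector k B v y"
    "form_D\<theta> k (\<lambda>i. bform (vcnj y) (B i) x) v \<noteq> 0"
    "\<And>x'. right_eigenvector k B v x' \<Longrightarrow> \<exists>a. x' = a *s x"
    "\<And>y'. left_eigenvector k B v y' \<Longrightarrow> \<exists>a. y' = a *s y"
proof -
  have v: "v \<noteq> 0" by (rule simple_eigenvalue_nonzero[OF simple])
  define M where "M = hmp_eval k B (v $ 1) (v $ 2)"
  \<comment> \<open>The definition provides a singular value of P at some representative u;
    homogeneity carries it over to v.\<close>
  obtain u where u: "representative (line v) u" "det (hmp_eval k B (u $ 1) (u $ 2)) = 0"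
    using simple by (auto simp: simple_eigenvalue_def hmp_eigenvalue_def)
  obtain c' where "c' \<noteq> 0" "u = c' *s v"
    using u representative_line_iff[OF v] by blast
  with u obtain c where c: "c \<noteq> 0" "det (\<chi> i j. c * M $ i $ j) = 0"
    unfolding M_def by (metis hmp_eval_scale power_not_zero)
  obtain x z where x: "x \<noteq> 0" "M *v x = 0" and z: "z \<noteq> 0" "z v* M = 0"
    using singular_null_vectors[OF c(2)] unfolding scaled_matrix_kernel[OF c(1)] by blast
  have "alg_mult k B v = 1"
    using simple v by (simp add: simple_eigenvalue_def representative_def)
  then have nz: "form_D\<theta> k (\<lambda>i. bform z' (B i) x') v \<noteq> 0"
    if "x' \<noteq> 0" "M *v x' = 0" "z' \<noteq> 0" "z' v* M = 0" for x' z'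
    using that form_D\<theta>_nonzero[OF \<open>k \<ge> 1\<close> v alg_mult_one] assms(1) v by (simp add: M_def)
  have "\<exists>a. x' = a *s x" if x': "M *v x' = 0" for x'
  proof -
    \<comment> \<open>The quotient is chosen so that the derivative vanishes for x' - a x. This
      vector lies in the kernel of M, so by \<open>nz\<close> it must be 0.\<close>
    define a where "a = form_D\<theta> k (\<lambda>i. bform z (B i) x') v / form_D\<theta> k (\<lambda>i. bform z (B i) x) v"
    have "bform z N (x' - a *s x) = 1 * bform z N x' + (- a) * bform z N x" for N
      by (simp add: bform_expand sum_distrib_left algebra_simps sum.distrib sum_subtractf sum_negf)
    then have "form_D\<theta> k (\<lambda>i. bform z (B i) (x' - a *s x)) v =
      1 * form_D\<theta> k (\<lambda>i. bform z (B i) x') v + (- a) * form_D\<theta> k (\<lambda>i. bform z (B i) x) v"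
      by (simp only: form_D\<theta>_add)
    also have "\<dots> = 0"
      using nz[OF x z] by (simp add: a_def)
    finally have "x' - a *s x = 0"
      using nz[OF _ _ z, of "x' - a *s x"] x x'
      by (auto simp: matrix_vector_mult_diff_distrib vector_scalar_commute)
    then show ?thesis by auto
  qed
  moreover have "\<exists>a. z' = a *s z" if z': "z' v* M = 0" for z'
  proof -
    define a where "a = form_D\<theta> k (\<lambda>i. bform z' (B i) x) v / form_D\<theta> k (\<lambda>i. bform z (B i) x) v"
    have "bform (z' - a *s z) N x = 1 * bform z' N x + (- a) * bform z N x" for N
      by (simp add: bform_expand sum_distrib_left algebra_simps sum.distrib sum_subtractf sum_negf)
    then have "form_D\<theta> k (\<lambda>i. bform (z' - a *s z) (B i) x) v =
      1 * form_D\<theta> k (\<lambda>i. bform z' (B i) x) v + (- a) * form_D\<theta> k (\<lambda>i. bform z (B i) x) v"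
      by (simp only: form_D\<theta>_add)
    then have "form_D\<theta> k (\<lambda>i. bform (z' - a *s z) (B i) x) v = 0"
      using nz[OF x z] by (simp add: a_def)
    moreover have "(z' - a *s z) v* M = z' v* M - a *s (z v* M)"
      by (simp add: vec_eq_iff vector_matrix_mult_def sum_distrib_left algebra_simps sum_subtractf)
    ultimately have "z' - a *s z = 0"
      using nz[OF x, of "z' - a *s z"] z z'
      by auto
    then show ?thesis by auto
  qed
  \<comment> \<open>z is a left null vector without conjugation, so the left eigenvector is its
    conjugate, and scalars are conjugated as well.\<close>
  then have "\<exists>a. y' = a *s vcnj z" if "vcnj y' v* M = 0" for y'
    using that by (metis vcnj_vcnj vcnj_scale)
  ultimately show ?thesis
    using that[of x "vcnj z"] x z nz by (auto simp: right_eigenvector_def left_eigenvector_def simp flip: M_def)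
qed

text \<open>Independence of the choices: another representative c v multiplies the monomial sum and
  the denominator by |c|^k, and scaled eigenvectors change numerator and denominator by the same
  factor.\<close>

lemma kappa_theta_eq:
  assumes "k \<ge> 1" "v \<noteq> 0" and x: "right_eigenvector k B v x" and y: "left_eigenvector k B v y"
    and x_unique: "\<And>x'. right_eigenvector k B v x' \<Longrightarrow> \<exists>a. x' = a *s x"
    and y_unique: "\<And>y'. left_eigenvector k B v y' \<Longrightarrow> \<exists>a. y' = a *s y"
  shows "kappa_theta (\<lambda>_. \<omega>) k B (line v) =
    monomial_sum k v * \<omega> * (norm y * norm x / cmod (form_D\<theta> k (\<lambda>i. bform (vcnj y) (B i) x) v))"
    (is "_ = ?\<kappa>")
  unfolding kappa_theta_def
proof (rule the_equality)
  have "representative (line v) v"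
    using \<open>v \<noteq> 0\<close> by (simp add: representative_def)
  then show "\<exists>u x y. representative (line v) u \<and> right_eigenvector k B u x \<and> left_eigenvector k B u y \<and>
      ?\<kappa> = kappa_formula (\<lambda>_. \<omega>) k B u x y"
    using x y by (intro exI[of _ v] exI[of _ x] exI[of _ y]) (simp add: kappa_formula_const)
next
  fix \<kappa>
  assume "\<exists>u x y. representative (line v) u \<and> right_eigenvector k B u x \<and> left_eigenvector k B u y \<and>
      \<kappa> = kappa_formula (\<lambda>_. \<omega>) k B u x y"
  then obtain u x' y' where u: "representative (line v) u" and x': "right_eigenvector k B u x'"
    and y': "left_eigenvector k B u y'" and \<kappa>: "\<kappa> = kappa_formula (\<lambda>_. \<omega>) k B u x' y'"
    by blast
  obtain c where c: "c \<noteq> 0" "u = c *s v"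
    using u representative_line_iff[OF \<open>v \<noteq> 0\<close>] by blast
  have "right_eigenvector k B v x'" "left_eigenvector k B v y'"
    using x' y' scaled_matrix_kernel[OF power_not_zero[OF c(1)]]
    unfolding right_eigenvector_def left_eigenvector_def c(2) hmp_eval_scale by blast+
  then obtain a b where a: "x' = a *s x" and b: "y' = b *s y"
    using x_unique y_unique by blast
  then have ab: "a \<noteq> 0" "b \<noteq> 0"
    using x' y' by (auto simp: right_eigenvector_def left_eigenvector_def)
  have "form_D\<theta> k (\<lambda>i. bform (vcnj y') (B i) x') u = 
      cnj b * a * form_D\<theta> k (\<lambda>i. bform (vcnj y) (B i) x) u"
    using form_D\<theta>_add[of k "cnj b * a" "\<lambda>i. bform (vcnj y) (B i) x" 0]
    by (simp add: a b vcnj_scale bform_scale)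
  then have "cmod (form_D\<theta> k (\<lambda>i. bform (vcnj y') (B i) x') u) =
      cmod b * cmod a * (cmod c ^ k * cmod (form_D\<theta> k (\<lambda>i. bform (vcnj y) (B i) x) v))"
    using c \<open>k \<ge> 1\<close> by (simp add: norm_mult cmod_form_D\<theta>_scale)
  then show "\<kappa> = ?\<kappa>"
    using ab c by (simp add: \<kappa> kappa_formula_const monomial_sum_scale norm_vscale a b)
qed

section \<open>Norm estimates\<close>

lemma spectral_norm_pos_le: "0 \<le> spectral_norm (M :: complex^'n^'n)"
  unfolding spectral_norm_def by (intro onorm_pos_le) simp

lemma spectral_norm_pos: "M \<noteq> 0 \<Longrightarrow> 0 < spectral_norm (M :: complex^'n^'n)"
  unfolding spectral_norm_def using onorm_pos_lt[of "(*v) M"] matrix_eq[of M 0] by auto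

lemma norm_mult_spectral: "norm (M *v x) \<le> spectral_norm M * norm (x :: complex^'n)"
  unfolding spectral_norm_def by (intro onorm) simp

lemma spectral_norm_linear_combination:
  fixes B :: "'i \<Rightarrow> complex^'n^'n"
  assumes "\<And>r c. M $ r $ c = (\<Sum>i\<in>I. w i * B i $ r $ c)"
  shows "spectral_norm M \<le> (\<Sum>i\<in>I. cmod (w i) * spectral_norm (B i))"
  unfolding spectral_norm_def[of M]
proof (rule onorm_bound)
  show "0 \<le> (\<Sum>i\<in>I. cmod (w i) * spectral_norm (B i))"
    by (intro sum_nonneg mult_nonneg_nonneg spectral_norm_pos_le) simp
  fix x :: "complex^'n"
  have "(\<Sum>c\<in>UNIV. \<Sum>i\<in>I. w i * B i $ r $ c * x $ c) = (\<Sum>i\<in>I. \<Sum>c\<in>UNIV. w i * B i $ r $ c * x $ c)" for r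
    by (rule sum.swap)
  then have "M *v x = (\<Sum>i\<in>I. w i *s (B i *v x))"
    by (simp add: vec_eq_iff matrix_vector_mult_def assms sum_distrib_right sum_distrib_left mult.assoc)
  also have "norm \<dots> \<le> (\<Sum>i\<in>I. norm (w i *s (B i *v x)))"
    by (rule norm_sum)
  also have "\<dots> \<le> (\<Sum>i\<in>I. cmod (w i) * spectral_norm (B i) * norm x)"
    unfolding norm_vscale mult.assoc by (intro sum_mono mult_left_mono norm_mult_spectral) simp
  finally show "norm (M *v x) \<le> (\<Sum>i\<in>I. cmod (w i) * spectral_norm (B i)) * norm x"
    by (simp add: sum_distrib_right)
qed

section \<open>Coefficient norms under the Moebius transform\<close>

definition max_norm :: "nat \<Rightarrow> (nat \<Rightarrow> complex^'n^'n) \<Rightarrow> real" where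
  "max_norm k B = Max ((\<lambda>j. spectral_norm (B j)) ` {..k})"

lemma spectral_norm_le_max_norm: "i \<le> k \<Longrightarrow> spectral_norm (B i) \<le> max_norm k B"
  by (simp add: max_norm_def)

lemma max_norm_le: "(\<And>i. i \<le> k \<Longrightarrow> spectral_norm (B i) \<le> c) \<Longrightarrow> max_norm k B \<le> c"
  by (simp add: max_norm_def)

lemma max_norm_nonneg: "0 \<le> max_norm k B"
  using spectral_norm_le_max_norm[of 0 k B] spectral_norm_pos_le[of "B 0"] by simp

lemma max_norm_cong: "(\<And>i. i \<le> k \<Longrightarrow> B i = C i) \<Longrightarrow> max_norm k B = max_norm k C"
  by (simp add: max_norm_def)

lemma max_norm_pos:
  fixes B :: "nat \<Rightarrow> complex^'n^'n"
  assumes "hmp_regular k B"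
  shows "0 < max_norm k B"
proof -
  have "\<exists>i\<le>k. B i \<noteq> 0"
  proof (rule ccontr)
    assume "\<not> (\<exists>i\<le>k. B i \<noteq> 0)"
    then have "hmp_poly k B = mat 0"
      by (simp add: hmp_poly_def vec_eq_iff mat_def)
    with assms show False by (simp add: hmp_regular_def del: mat_0)
  qed
  then show ?thesis
    using spectral_norm_pos spectral_norm_le_max_norm by (metis less_le_trans)
qed

lemma spectral_norm_moebius_le:
  "spectral_norm (moebius A k B l) \<le> (\<Sum>i\<le>k. cmod (coeff ([:A $ 1 $ 2, A $ 1 $ 1:] ^ i * [:A $ 2 $ 2, A $ 2 $ 1:] ^ (k - i)) l)) * max_norm k B"
proof -
  have "spectral_norm (moebius A k B l) \<le> (\<Sum>i\<le>k. cmod (coeff ([:A $ 1 $ 2, A $ 1 $ 1:] ^ i * [:A $ 2 $ 2, A $ 2 $ 1:] ^ (k - i)) l) * spectral_norm (B i))"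
    by (rule spectral_norm_linear_combination) (simp add: moebius_def)
  also have "\<dots> \<le> (\<Sum>i\<le>k. cmod (coeff ([:A $ 1 $ 2, A $ 1 $ 1:] ^ i * [:A $ 2 $ 2, A $ 2 $ 1:] ^ (k - i)) l) * max_norm k B)"
    by (intro sum_mono mult_left_mono spectral_norm_le_max_norm) simp_all
  finally show ?thesis by (simp add: sum_distrib_right)
qed

text \<open>The coefficients of the product are b p_l + a p_(l-1).\<close>

lemma coeff_linear_mult_le:
  fixes p :: "complex poly"
  assumes "\<And>l. cmod (coeff p l) \<le> C"
  shows "cmod (coeff ([:b, a:] * p) l) \<le> (cmod a + cmod b) * C"
proof -
  \<comment> \<open>At l = 0 there is no p_(l-1), and the second summand is 0 instead.\<close>
  have "0 \<le> C" using assms[of 0] norm_ge_zero order_trans by blast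
  have "cmod (coeff ([:b, a:] * p) l) \<le> cmod (b * coeff p l) + cmod (coeff (pCons 0 (smult a p)) l)"
    by (simp add: norm_triangle_ineq)
  also have "cmod (b * coeff p l) \<le> cmod b * C"
    unfolding norm_mult by (intro mult_left_mono assms) simp
  also have "cmod (coeff (pCons 0 (smult a p)) l) \<le> cmod a * C"
    using \<open>0 \<le> C\<close> assms by (auto simp: coeff_pCons norm_mult mult_left_mono split: nat.split)
  finally show ?thesis by (simp add: algebra_simps)
qed

lemma coeff_linear_power_mult_le:
  fixes p :: "complex poly"
  assumes "\<And>l. cmod (coeff p l) \<le> C"
  shows "cmod (coeff ([:b, a:] ^ i * p) l) \<le> (cmod a + cmod b) ^ i * C"
proof (induction i arbitrary: l)
  case (Suc i)
  show ?case
    using coeff_linear_mult_le[OF Suc, of b a l] by (simp only: power_Suc mult.assoc)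
qed (simp add: assms)

lemma coeff_linear_powers_le:
  "cmod (coeff ([:b, a:] ^ i * [:e, c:] ^ j) l) \<le> (cmod a + cmod b) ^ i * (cmod c + cmod e) ^ j"
proof -
  have "cmod (coeff 1 l) \<le> 1" for l by simp
  from coeff_linear_power_mult_le[OF this]
  have "cmod (coeff ([:e, c:] ^ j) l) \<le> (cmod c + cmod e) ^ j" for l by simp
  then show ?thesis by (rule coeff_linear_power_mult_le)
qed

lemma norm_inf_2:
  fixes A :: "complex^2^2"
  shows "norm_inf A = max (cmod (A $ 1 $ 1) + cmod (A $ 1 $ 2)) (cmod (A $ 2 $ 1) + cmod (A $ 2 $ 2))"
  by (simp add: norm_inf_def UNIV_2)

lemma norm_inf_nonneg: "0 \<le> norm_inf (A :: complex^2^2)"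
  by (simp add: norm_inf_2 le_max_iff_disj)

text \<open>The two linear factors have the row sums of A as coefficient sums, so each of the k + 1
  summands contributes at most the k-th power of the larger one.\<close>

lemma max_norm_moebius_le:
  "max_norm k (moebius A k B) \<le> (real k + 1) * norm_inf A ^ k * max_norm k B"
proof (rule max_norm_le)
  fix l
  have "cmod (coeff ([:A $ 1 $ 2, A $ 1 $ 1:] ^ i * [:A $ 2 $ 2, A $ 2 $ 1:] ^ (k - i)) l) \<le> norm_inf A ^ k"
    if "i \<le> k" for i
  proof -
    have "norm_inf A ^ k = norm_inf A ^ i * norm_inf A ^ (k - i)"
      using that by (simp flip: power_add)
    also have "\<dots> \<ge> (cmod (A $ 1 $ 1) + cmod (A $ 1 $ 2)) ^ i * (cmod (A $ 2 $ 1) + cmod (A $ 2 $ 2)) ^ (k - i)"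
      by (intro mult_mono power_mono) (auto simp: norm_inf_nonneg, auto simp: norm_inf_2)
    finally show ?thesis
      using coeff_linear_powers_le order_trans by blast
  qed
  then have "(\<Sum>i\<le>k. cmod (coeff ([:A $ 1 $ 2, A $ 1 $ 1:] ^ i * [:A $ 2 $ 2, A $ 2 $ 1:] ^ (k - i)) l)) \<le> (\<Sum>i\<le>k. norm_inf A ^ k)"
    by (intro sum_mono) simp
  then show "spectral_norm (moebius A k B l) \<le> (real k + 1) * norm_inf A ^ k * max_norm k B"
    using spectral_norm_moebius_le[of A k B l] mult_right_mono[OF _ max_norm_nonneg] 
    by (fastforce intro: order_trans simp: add.commute)
qed

definition norm_one :: "complex^2^2 \<Rightarrow> real" where
  "norm_one A = max (cmod (A $ 1 $ 1) + cmod (A $ 2 $ 1)) (cmod (A $ 1 $ 2) + cmod (A $ 2 $ 2))"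

text \<open>For k = 1 each new coefficient combines B_0 and B_1 with the entries of one column of
  A.\<close>

lemma max_norm_moebius_1_le: "max_norm 1 (moebius A 1 B) \<le> norm_one A * max_norm 1 B"
proof (rule max_norm_le)
  fix l :: nat
  assume "l \<le> 1"
  then have "l = 0 \<or> l = 1" by auto
  then have "(\<Sum>i\<le>1. cmod (coeff ([:A $ 1 $ 2, A $ 1 $ 1:] ^ i * [:A $ 2 $ 2, A $ 2 $ 1:] ^ (1 - i)) l)) \<le> norm_one A"
    by (auto simp: norm_one_def)
  then show "spectral_norm (moebius A 1 B l) \<le> norm_one A * max_norm 1 B"
    using spectral_norm_moebius_le[of A 1 B l] mult_right_mono[OF _ max_norm_nonneg]
    by (fastforce intro: order_trans)
qed

lemma matrix_inv_mult:
  assumes "invertible A"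
  shows "A ** matrix_inv A = mat 1" "matrix_inv A ** A = mat 1"
  using someI_ex[of "\<lambda>C. A ** C = mat 1 \<and> C ** A = mat 1"] assms
  by (auto simp: invertible_def matrix_inv_def)

text \<open>det A times the inverse is the adjugate, whose rows consist, up to sign, of the entries
  of the columns of A.\<close>

lemma det_mult_norm_inf_inv:
  fixes A :: "complex^2^2"
  assumes "invertible A"
  shows "cmod (det A) * norm_inf (matrix_inv A) = norm_one A"
proof -
  define C where "C = matrix_inv A"
  have "A ** C = mat 1" "C ** A = mat 1"
    using matrix_inv_mult[OF assms] by (simp_all add: C_def)
  then have e: "A $ 1 $ 1 * C $ 1 $ 1 + A $ 1 $ 2 * C $ 2 $ 1 = 1" "A $ 1 $ 1 * C $ 1 $ 2 + A $ 1 $ 2 * C $ 2 $ 2 = 0"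
    "A $ 2 $ 1 * C $ 1 $ 1 + A $ 2 $ 2 * C $ 2 $ 1 = 0" "A $ 2 $ 1 * C $ 1 $ 2 + A $ 2 $ 2 * C $ 2 $ 2 = 1"
    by (simp_all add: vec_eq_iff forall_2 matrix_matrix_mult_def sum_2 mat_def)
  have "det A * C $ 1 $ 1 = A $ 2 $ 2" "det A * C $ 1 $ 2 = - (A $ 1 $ 2)"
    "det A * C $ 2 $ 1 = - (A $ 2 $ 1)" "det A * C $ 2 $ 2 = A $ 1 $ 1"
    using e unfolding det_2 by algebra+
  then have "cmod (det A) * cmod (C $ 1 $ 1) = cmod (A $ 2 $ 2)" "cmod (det A) * cmod (C $ 1 $ 2) = cmod (A $ 1 $ 2)"
    "cmod (det A) * cmod (C $ 2 $ 1) = cmod (A $ 2 $ 1)" "cmod (det A) * cmod (C $ 2 $ 2) = cmod (A $ 1 $ 1)"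
    by (metis norm_mult norm_minus_cancel)+
  then show ?thesis
    unfolding C_def[symmetric] norm_inf_2 norm_one_def
    by (simp add: max_mult_distrib_left distrib_left max.commute add.commute)
qed

text \<open>A row takes one entry from each of the two columns. With
  \<open>det_mult_norm_inf_inv\<close> this bounds 1 / |det A| by 2 |A^-1| / |A|.\<close>

lemma norm_inf_le_norm_one: "norm_inf A \<le> 2 * norm_one A"
proof -
  have "max (a + b) (c + d) \<le> 2 * max (a + c) (b + d)"
    if "0 \<le> a" "0 \<le> b" "0 \<le> c" "0 \<le> d" for a b c d :: real
    using that by (auto simp: max_def)
  then show ?thesis
    unfolding norm_inf_2 norm_one_def by (meson norm_ge_zero)
qed

text \<open>Substituting A C = 1 leaves the values at \<beta> = 1 unchanged, and a polynomial
  function determines its coefficients. Beyond index k the transform has only zero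
  coefficients.\<close>

lemma moebius_inverse:
  assumes "A ** C = mat 1" "i \<le> k"
  shows "moebius C k (moebius A k B) i = B i"
proof -
  have eval: "hmp_eval k (moebius C k (moebius A k B)) t 1 = hmp_eval k B t 1" for t
  proof -
    have e: "A $ 1 $ 1 * C $ 1 $ 1 + A $ 1 $ 2 * C $ 2 $ 1 = 1" "A $ 1 $ 1 * C $ 1 $ 2 + A $ 1 $ 2 * C $ 2 $ 2 = 0"
      "A $ 2 $ 1 * C $ 1 $ 1 + A $ 2 $ 2 * C $ 2 $ 1 = 0" "A $ 2 $ 1 * C $ 1 $ 2 + A $ 2 $ 2 * C $ 2 $ 2 = 1"
      using assms(1) by (simp_all add: vec_eq_iff forall_2 matrix_matrix_mult_def sum_2 mat_def)
    have "A $ 1 $ 1 * (C $ 1 $ 1 * t + C $ 1 $ 2 * 1) + A $ 1 $ 2 * (C $ 2 $ 1 * t + C $ 2 $ 2 * 1) = t"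
      "A $ 2 $ 1 * (C $ 1 $ 1 * t + C $ 1 $ 2 * 1) + A $ 2 $ 2 * (C $ 2 $ 1 * t + C $ 2 $ 2 * 1) = 1"
      using e by algebra+
    then show ?thesis by (simp only: hmp_eval_moebius)
  qed
  have "moebius C k (moebius A k B) i $ r $ c = B i $ r $ c" for r c
  proof -
    have "(\<Sum>i\<le>k. moebius C k (moebius A k B) i $ r $ c * t ^ i) = (\<Sum>i\<le>k. B i $ r $ c * t ^ i)" for t
      using arg_cong[OF eval[of t], of "\<lambda>M. M $ r $ c"] by (simp add: hmp_eval_def mult.commute)
    then show ?thesis
      using assms(2) polyfun_eq_coeffs[of "\<lambda>i. moebius C k (moebius A k B) i $ r $ c" k "\<lambda>i. B i $ r $ c"]
      by blast
  qed
  then show ?thesis by (simp add: vec_eq_iff)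
qed

section \<open>Vectors in the plane compared with the maximum norm\<close>

definition max_abs :: "complex^2 \<Rightarrow> real" where
  "max_abs v = max (cmod (v $ 1)) (cmod (v $ 2))"

lemma max_abs_nonneg: "0 \<le> max_abs v"
  by (simp add: max_abs_def le_max_iff_disj)

lemma max_abs_mult_le: "max_abs (A *v v) \<le> norm_inf A * max_abs v"
proof -
  have "cmod ((A *v v) $ i) \<le> norm_inf A * max_abs v" for i
  proof -
    have "cmod ((A *v v) $ i) \<le> cmod (A $ i $ 1) * cmod (v $ 1) + cmod (A $ i $ 2) * cmod (v $ 2)"
      unfolding matrix_vector_mult_def by (simp add: sum_2 norm_triangle_le norm_mult)
    also have "\<dots> \<le> cmod (A $ i $ 1) * max_abs v + cmod (A $ i $ 2) * max_abs v"
      by (intro add_mono mult_left_mono) (auto simp: max_abs_def)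
    also have "\<dots> = (cmod (A $ i $ 1) + cmod (A $ i $ 2)) * max_abs v"
      by (simp add: algebra_simps)
    also have "\<dots> \<le> norm_inf A * max_abs v"
      using exhaust_2[of i] by (intro mult_right_mono max_abs_nonneg) (auto simp: norm_inf_2)
    finally show ?thesis .
  qed
  then show ?thesis by (simp add: max_abs_def[of "A *v v"])
qed

lemma monomial_sum_le: "monomial_sum k v \<le> (real k + 1) * max_abs v ^ k"
proof -
  have "cmod (v $ 1) ^ i * cmod (v $ 2) ^ (k - i) \<le> max_abs v ^ k" if "i \<le> k" for i
  proof -
    have "cmod (v $ 1) ^ i * cmod (v $ 2) ^ (k - i) \<le> max_abs v ^ i * max_abs v ^ (k - i)"
      by (intro mult_mono power_mono) (auto simp: max_abs_def le_max_iff_disj)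
    also have "\<dots> = max_abs v ^ k" using that by (simp flip: power_add)
    finally show ?thesis .
  qed
  then have "monomial_sum k v \<le> (\<Sum>i\<le>k. max_abs v ^ k)"
    unfolding monomial_sum_def by (intro sum_mono) simp
  then show ?thesis by (simp add: add.commute)
qed

lemma monomial_sum_ge: "max_abs v ^ k \<le> monomial_sum k v"
proof -
  have "cmod (v $ 1) ^ i * cmod (v $ 2) ^ (k - i) \<le> monomial_sum k v" if "i \<le> k" for i
    unfolding monomial_sum_def using that by (intro member_le_sum) auto
  \<comment> \<open>The end terms are the pure k-th powers of the two moduli.\<close>
  from this[of 0] this[of k] show ?thesis
    by (simp add: max_abs_def max_def)
qed

lemma norm_sq_le: "norm_sq v \<le> 2 * (max_abs v)\<^sup>2"
proof -
  have "(cmod (v $ 1))\<^sup>2 \<le> (max_abs v)\<^sup>2" "(cmod (v $ 2))\<^sup>2 \<le> (max_abs v)\<^sup>2"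
    by (intro power_mono; simp add: max_abs_def)+
  then show ?thesis by (simp add: norm_sq_def)
qed

lemma norm_sq_ge: "(max_abs v)\<^sup>2 \<le> norm_sq v"
  by (simp add: norm_sq_def max_abs_def max_def)

lemma max_abs_pos: "v \<noteq> 0 \<Longrightarrow> 0 < max_abs v"
  by (auto simp: max_abs_def vec_eq_iff forall_2 less_max_iff_disj)

lemma monomial_sum_pos: "v \<noteq> 0 \<Longrightarrow> 0 < monomial_sum k v"
  using monomial_sum_ge[of v k] max_abs_pos[of v] by (meson less_le_trans zero_less_power)

text \<open>\<open>monomial_sum 1 v\<close> is the 1-norm, so this is Hoelder's inequality for v
  with itself.\<close>

lemma norm_sq_le_monomial_sum: "norm_sq v \<le> max_abs v * monomial_sum 1 v"
proof -
  have "(cmod (v $ i))\<^sup>2 \<le> max_abs v * cmod (v $ i)" for i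
    unfolding power2_eq_square using exhaust_2[of i] by (intro mult_right_mono) (auto simp: max_abs_def)
  from add_mono[OF this this, of 1 2] show ?thesis
    by (simp add: norm_sq_def monomial_sum_def algebra_simps)
qed

lemma max_abs_mult_monomial_sum_le: "max_abs v * monomial_sum 1 v \<le> 2 * norm_sq v"
proof -
  have "max_abs v * monomial_sum 1 v \<le> max_abs v * (2 * max_abs v)"
    using monomial_sum_le[of 1 v] by (intro mult_left_mono max_abs_nonneg) simp
  then show ?thesis
    using norm_sq_ge[of v] by (simp add: power2_eq_square)
qed

section \<open>The ratio of condition numbers\<close>

text \<open>What remains of Q when v = A w, after the eigenvectors and the derivative have
  cancelled. Taking both v and w as arguments lets them be exchanged when A is inverted.\<close>

definition kappa_ratio :: "complex^2^2 \<Rightarrow> nat \<Rightarrow> (nat \<Rightarrow> complex^'n^'n) \<Rightarrow> complex^2 \<Rightarrow> complex^2 \<Rightarrow> real" where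
  "kappa_ratio A k B v w =
     monomial_sum k w * max_norm k (moebius A k B) * norm_sq v /
     (monomial_sum k v * max_norm k B * norm_sq w * cmod (det A))"

text \<open>The coefficient norms contribute |det A| |A^-1|, whose determinant cancels, and the
  vectors contribute 2 |A|.\<close>

lemma kappa_ratio_le_1:
  assumes "invertible A" "w = matrix_inv A *v v" "v = A *v w" "v \<noteq> 0" "w \<noteq> 0" "0 < max_norm 1 B"
  shows "kappa_ratio A 1 B v w \<le> 4 * cond_inf A"
proof -
  define a a' d where "a = norm_inf A" and "a' = norm_inf (matrix_inv A)" and "d = cmod (det A)"
  have nonneg: "0 \<le> a" "0 \<le> a'" by (simp_all add: a_def a'_def norm_inf_nonneg)
  have "d > 0" using assms(1) by (simp add: d_def invertible_det_nz)
  have norm: "max_norm 1 (moebius A 1 B) \<le> d * a' * max_norm 1 B"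
    unfolding d_def a'_def det_mult_norm_inf_inv[OF assms(1)] by (rule max_norm_moebius_1_le)
  have size: "monomial_sum 1 w * norm_sq v \<le> 2 * a * (monomial_sum 1 v * norm_sq w)"
  proof -
    \<comment> \<open>One factor of |v|^2 is estimated by |A| times the maximum norm of w, the other
      is the 1-norm of v; this keeps the power of |A| at one.\<close>
    have "monomial_sum 1 w * norm_sq v \<le> monomial_sum 1 w * (a * max_abs w * monomial_sum 1 v)"
      using norm_sq_le_monomial_sum[of v] max_abs_mult_le[of A w] monomial_sum_pos[OF \<open>v \<noteq> 0\<close>, of 1] monomial_sum_pos[OF \<open>w \<noteq> 0\<close>, of 1]
      unfolding assms(3)[symmetric] a_def[symmetric]
      by (intro mult_left_mono order_trans[OF norm_sq_le_monomial_sum] mult_right_mono) auto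
    also have "\<dots> = a * monomial_sum 1 v * (max_abs w * monomial_sum 1 w)" by simp
    also have "\<dots> \<le> a * monomial_sum 1 v * (2 * norm_sq w)"
      using nonneg monomial_sum_pos[OF \<open>v \<noteq> 0\<close>, of 1] by (intro mult_left_mono max_abs_mult_monomial_sum_le) auto
    finally show ?thesis by (simp add: mult_ac)
  qed
  have "max_norm 1 (moebius A 1 B) * (monomial_sum 1 w * norm_sq v) \<le>
      (d * a' * max_norm 1 B) * (2 * a * (monomial_sum 1 v * norm_sq w))"
    by (rule mult_mono[OF norm size])
      (use monomial_sum_pos[OF \<open>w \<noteq> 0\<close>, of 1] norm_sq_pos[OF \<open>v \<noteq> 0\<close>] nonneg \<open>0 < d\<close> \<open>0 < max_norm 1 B\<close> in auto)
  also have "\<dots> = 2 * (a * a') * (monomial_sum 1 v * max_norm 1 B * norm_sq w * d)" by simp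
  also have "\<dots> \<le> 4 * (a * a') * (monomial_sum 1 v * max_norm 1 B * norm_sq w * d)"
    using monomial_sum_pos[OF \<open>v \<noteq> 0\<close>, of 1] norm_sq_pos[OF \<open>w \<noteq> 0\<close>] nonneg \<open>0 < d\<close> \<open>0 < max_norm 1 B\<close>
    by (intro mult_right_mono) auto
  finally show ?thesis
    using monomial_sum_pos[OF \<open>v \<noteq> 0\<close>, of 1] norm_sq_pos[OF \<open>w \<noteq> 0\<close>] \<open>0 < d\<close> \<open>0 < max_norm 1 B\<close>
    unfolding kappa_ratio_def cond_inf_def a_def[symmetric] a'_def[symmetric] d_def[symmetric]
    by (subst pos_divide_le_eq) (simp_all add: mult_ac)
qed

text \<open>The coefficients bring |A|^k, one factor of which is traded for 2 |det A| |A^-1|. Of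
  m^k, two factors cancel against |w|^2 and the other k - 2 are bounded through |A^-1|. Both norms
  thus reach the power k - 1.\<close>

lemma kappa_ratio_le:
  assumes "k \<ge> 2" "invertible A" "w = matrix_inv A *v v" "v \<noteq> 0" "w \<noteq> 0" "0 < max_norm k B"
  shows "kappa_ratio A k B v w \<le> Z_const k * cond_inf A ^ (k - 1)"
proof -
  define a a' d where "a = norm_inf A" and "a' = norm_inf (matrix_inv A)" and "d = cmod (det A)"
  define m M \<omega> where "m = max_abs w" and "M = max_abs v" and "\<omega> = max_norm k B"
  obtain j where k: "k = Suc (Suc j)"
    using \<open>k \<ge> 2\<close> by (metis le_Suc_ex add_2_eq_Suc)
  have nonneg: "0 \<le> a" "0 \<le> a'" by (simp_all add: a_def a'_def norm_inf_nonneg)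
  have pos: "0 < d" "0 < m" "0 < M" "0 < \<omega>"
    using assms by (simp_all add: d_def invertible_det_nz m_def M_def \<omega>_def max_abs_pos)
  have "a \<le> 2 * (d * a')"
    unfolding a_def d_def a'_def det_mult_norm_inf_inv[OF assms(2)] by (rule norm_inf_le_norm_one)
  have "m \<le> a' * M"
    using max_abs_mult_le[of "matrix_inv A" v] assms(3) by (simp add: m_def a'_def M_def)
  have "monomial_sum k w * (max_norm k (moebius A k B) * norm_sq v) \<le>
      ((real k + 1) * m ^ k) * (((real k + 1) * a ^ k * \<omega>) * (2 * M\<^sup>2))"
    unfolding m_def a_def \<omega>_def M_def
    using monomial_sum_pos[OF \<open>w \<noteq> 0\<close>, of k] norm_sq_pos[OF \<open>v \<noteq> 0\<close>] max_norm_nonneg[of k "moebius A k B"]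
      max_norm_nonneg[of k B]
    by (intro mult_mono monomial_sum_le max_norm_moebius_le norm_sq_le)
      (auto simp: norm_inf_nonneg max_abs_nonneg)
  \<comment> \<open>Here j = k - 2; the factors to be estimated, m^j and one a, are split
    off.\<close>
  also have "\<dots> = 2 * (real k + 1)\<^sup>2 * \<omega> * M\<^sup>2 * m\<^sup>2 * a ^ Suc j * (m ^ j * a)"
    by (simp add: k power2_eq_square)
  also have "\<dots> \<le> 2 * (real k + 1)\<^sup>2 * \<omega> * M\<^sup>2 * m\<^sup>2 * a ^ Suc j * ((a' * M) ^ j * (2 * (d * a')))"
    using \<open>m \<le> a' * M\<close> \<open>a \<le> 2 * (d * a')\<close> nonneg pos
    by (intro mult_left_mono mult_mono power_mono) auto
  also have "\<dots> = 4 * (real k + 1)\<^sup>2 * 1 * (a * a') ^ Suc j * (M ^ k * \<omega> * m\<^sup>2 * d)"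
    by (simp add: k power2_eq_square power_mult_distrib)
  \<comment> \<open>The factor 1 becomes the binomial coefficient of \<open>Z_const\<close>, and the
    powers of the maximum norms return to the quantities in the denominator.\<close>
  also have "\<dots> \<le> 4 * (real k + 1)\<^sup>2 * real (k choose (k div 2)) * (a * a') ^ Suc j *
      (monomial_sum k v * \<omega> * norm_sq w * d)"
  proof (intro mult_mono)
    have "0 < k choose (k div 2)" by simp
    then show "1 \<le> real (k choose (k div 2))" by linarith
    show "M ^ k \<le> monomial_sum k v" unfolding M_def by (rule monomial_sum_ge)
    show "m\<^sup>2 \<le> norm_sq w" unfolding m_def by (rule norm_sq_ge)
  qed (use nonneg pos monomial_sum_pos[OF \<open>v \<noteq> 0\<close>, of k] norm_sq_pos[OF \<open>w \<noteq> 0\<close>] in auto)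
  finally have "monomial_sum k w * (max_norm k (moebius A k B) * norm_sq v) \<le>
      Z_const k * cond_inf A ^ (k - 1) * (monomial_sum k v * \<omega> * norm_sq w * d)"
    by (simp add: Z_const_def cond_inf_def k a_def a'_def)
  then show ?thesis
    using monomial_sum_pos[OF \<open>v \<noteq> 0\<close>, of k] norm_sq_pos[OF \<open>w \<noteq> 0\<close>] pos
    unfolding kappa_ratio_def \<omega>_def[symmetric] d_def[symmetric]
    by (subst pos_divide_le_eq) (simp_all add: mult_ac)
qed

lemma moebius_eval: "hmp_eval k (moebius A k B) (w $ 1) (w $ 2) = hmp_eval k B ((A *v w) $ 1) ((A *v w) $ 2)"
  by (simp add: hmp_eval_moebius matrix_vector_mult_def sum_2)

text \<open>P at v and its transform at w are the same matrix, so both condition numbers can be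
  computed with the same x and y, and \<open>form_D\<theta>_moebius\<close> relates their
  denominators.\<close>

lemma Q_theta_p_eq_kappa_ratio:
  assumes "hmp_regular k B" "k \<ge> 1" "invertible A" "simple_eigenvalue k B (line v)"
  shows "Q_theta_p A k B v = kappa_ratio A k B v (matrix_inv A *v v)"
proof -
  define w where "w = matrix_inv A *v v"
  have v: "v = A *v w"
    by (simp add: w_def matrix_vector_mul_assoc matrix_inv_mult[OF assms(3)])
  have "v \<noteq> 0" by (rule simple_eigenvalue_nonzero[OF assms(4)])
  with v have "w \<noteq> 0" by auto
  obtain x y where x: "right_eigenvector k B v x" and y: "left_eigenvector k B v y"
    and nz: "form_D\<theta> k (\<lambda>i. bform (vcnj y) (B i) x) v \<noteq> 0"
    and x_unique: "\<And>x'. right_eigenvector k B v x' \<Longrightarrow> \<exists>a. x' = a *s x"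
    and y_unique: "\<And>y'. left_eigenvector k B v y' \<Longrightarrow> \<exists>a. y' = a *s y"
    using simple_eigenvectors[OF assms(1,2,4)] by blast
  define D where "D = cmod (form_D\<theta> k (\<lambda>i. bform (vcnj y) (B i) x) v)"
  define D' where "D' = cmod (form_D\<theta> k (\<lambda>i. bform (vcnj y) (moebius A k B i) x) w)"
  have eigen: "right_eigenvector k (moebius A k B) w = right_eigenvector k B v"
    "left_eigenvector k (moebius A k B) w = left_eigenvector k B v"
    by (auto simp: fun_eq_iff right_eigenvector_def left_eigenvector_def moebius_eval v)
  have "form_D\<theta> k (\<lambda>i. bform (vcnj y) (moebius A k B i) x) w * norm_sq v =
      norm_sq w * det A * form_D\<theta> k (\<lambda>i. bform (vcnj y) (B i) x) v"
  proof (rule form_D\<theta>_moebius[OF _ v])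
    show "form_val k (\<lambda>i. bform (vcnj y) (moebius A k B i) x) u = form_val k (\<lambda>i. bform (vcnj y) (B i) x) (A *v u)" for u
      by (simp add: moebius_eval flip: bform_hmp_eval)
    show "form_val k (\<lambda>i. bform (vcnj y) (B i) x) v = 0"
      using x unfolding bform_hmp_eval[symmetric] by (simp add: right_eigenvector_def bform_def)
  qed
  from arg_cong[OF this, of cmod] have "D' * norm_sq v = norm_sq w * cmod (det A) * D"
    using norm_sq_pos[OF \<open>v \<noteq> 0\<close>] norm_sq_pos[OF \<open>w \<noteq> 0\<close>] by (simp add: norm_mult D_def D'_def)
  then have D': "D' = norm_sq w * cmod (det A) * D / norm_sq v"
    using norm_sq_pos[OF \<open>v \<noteq> 0\<close>] by (simp add: field_simps)
  have "kappa_theta_p k B (line v) = monomial_sum k v * max_norm k B * (norm y * norm x / D)"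
    unfolding kappa_theta_p_def max_norm_def[symmetric] D_def
    by (rule kappa_theta_eq[OF assms(2) \<open>v \<noteq> 0\<close> x y x_unique y_unique])
  moreover have "kappa_theta_p k (moebius A k B) (line w) =
      monomial_sum k w * max_norm k (moebius A k B) * (norm y * norm x / D')"
    unfolding kappa_theta_p_def max_norm_def[symmetric] D'_def
    by (rule kappa_theta_eq[OF assms(2) \<open>w \<noteq> 0\<close>]) (simp_all add: eigen x y x_unique y_unique)
  moreover have "norm x > 0" "norm y > 0" "D > 0"
    using x y nz by (auto simp: right_eigenvector_def left_eigenvector_def D_def)
  ultimately show ?thesis
    using norm_sq_pos[OF \<open>v \<noteq> 0\<close>] by (simp add: Q_theta_p_def kappa_ratio_def D' mult_ac flip: w_def)
qed

text \<open>Transforming back restores the coefficients, and det C = 1 / det A, so numerator and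
  denominator change places.\<close>

lemma kappa_ratio_inverse:
  assumes "A ** C = mat 1"
  shows "kappa_ratio C k (moebius A k B) w v = 1 / kappa_ratio A k B v w"
proof -
  have "max_norm k (moebius C k (moebius A k B)) = max_norm k B"
    by (intro max_norm_cong moebius_inverse assms)
  moreover have "det A * det C = 1"
    using assms by (metis det_mul det_I)
  then have "cmod (det A) * cmod (det C) = 1"
    by (metis norm_mult norm_one)
  then have "cmod (det C) = 1 / cmod (det A)"
    by (metis mult_zero_left nonzero_mult_div_cancel_left zero_neq_one)
  ultimately show ?thesis
    by (simp add: kappa_ratio_def mult_ac)
qed

theorem theorem5p6:
  fixes k :: nat
    and B :: "nat \<Rightarrow> complex^'n^'n"
    and A :: "complex^2^2"
    and \<alpha>0 \<beta>0 :: complex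
  assumes "hmp_regular k B"
    and "invertible A"
    and "simple_eigenvalue k B (line (vector [\<alpha>0, \<beta>0]))"
  shows "(k = 1 \<longrightarrow>
            1 / (4 * cond_inf A) \<le> Q_theta_p A k B (vector [\<alpha>0, \<beta>0]) \<and>
            Q_theta_p A k B (vector [\<alpha>0, \<beta>0]) \<le> 4 * cond_inf A) \<and>
         (k \<ge> 2 \<longrightarrow>
            1 / (Z_const k * cond_inf A ^ (k - 1)) \<le> Q_theta_p A k B (vector [\<alpha>0, \<beta>0]) \<and>
            Q_theta_p A k B (vector [\<alpha>0, \<beta>0]) \<le> Z_const k * cond_inf A ^ (k - 1))"
proof -
  define v :: "complex^2" where "v = vector [\<alpha>0, \<beta>0]"
  define C where "C = matrix_inv A"
  define w where "w = C *v v"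
  note inv = matrix_inv_mult[OF assms(2), folded C_def]
  have v: "v = A *v w"
    by (simp add: w_def matrix_vector_mul_assoc inv)
  have "v \<noteq> 0" using simple_eigenvalue_nonzero assms(3) by (simp add: v_def)
  with v have "w \<noteq> 0" by auto
  have "invertible C" using inv by (auto simp: invertible_def)
  have "C ** matrix_inv C = mat 1" by (rule matrix_inv_mult[OF \<open>invertible C\<close>])
  then have C_inv: "matrix_inv C = A"
    by (metis inv(1) matrix_mul_assoc matrix_mul_lid matrix_mul_rid)
  have cond: "cond_inf C = cond_inf A"
    by (simp add: cond_inf_def C_inv) (simp add: C_def)
  define B' where "B' = moebius A k B"
  have B: "0 < max_norm k B" by (rule max_norm_pos[OF assms(1)])
  \<comment> \<open>Transforming back with C shows that the transformed coefficients cannot all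
    vanish.\<close>
  have "max_norm k B = max_norm k (moebius C k B')"
    unfolding B'_def by (intro max_norm_cong moebius_inverse[symmetric] inv)
  also have "\<dots> \<le> (real k + 1) * norm_inf C ^ k * max_norm k B'"
    by (rule max_norm_moebius_le)
  finally have B': "0 < max_norm k B'"
    using B max_norm_nonneg[of k B'] by (cases "max_norm k B' = 0") auto
  have R: "0 < kappa_ratio A k B v w"
    using B B' \<open>v \<noteq> 0\<close> \<open>w \<noteq> 0\<close> assms(2)
    by (simp add: kappa_ratio_def monomial_sum_pos norm_sq_pos invertible_det_nz flip: B'_def)
  have R': "kappa_ratio C k B' w v = 1 / kappa_ratio A k B v w"
    unfolding B'_def by (rule kappa_ratio_inverse[OF inv(1)])
  have lower: "1 / b \<le> kappa_ratio A k B v w" if "kappa_ratio C k B' w v \<le> b" for b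
  proof -
    have "0 < b" using that R unfolding R' by (meson less_le_trans zero_less_divide_1_iff)
    with that R show ?thesis unfolding R' by (simp add: field_simps)
  qed
  have Q: "Q_theta_p A k B v = kappa_ratio A k B v w" if "k \<ge> 1"
    using Q_theta_p_eq_kappa_ratio[OF assms(1) that assms(2)] assms(3) by (simp add: v_def w_def C_def)
  have w: "w = matrix_inv A *v v" by (simp add: w_def C_def)
  \<comment> \<open>For the lower bounds C takes the place of A, with v and w exchanged; the
    condition number stays the same by \<open>cond\<close>.\<close>
  have v': "v = matrix_inv C *v w" unfolding C_inv by (rule v)
  show ?thesis
    unfolding v_def[symmetric]
  proof (intro conjI impI)
    assume [simp]: "k = 1"
    show "Q_theta_p A k B v \<le> 4 * cond_inf A"
      using kappa_ratio_le_1[OF assms(2) w v \<open>v \<noteq> 0\<close> \<open>w \<noteq> 0\<close>] B Q by simp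
    show "1 / (4 * cond_inf A) \<le> Q_theta_p A k B v"
      using lower[of "4 * cond_inf A"] kappa_ratio_le_1[OF \<open>invertible C\<close> v' w_def \<open>w \<noteq> 0\<close> \<open>v \<noteq> 0\<close>, of B'] B' Q
      by (simp add: cond)
  next
    assume k: "k \<ge> 2"
    show "Q_theta_p A k B v \<le> Z_const k * cond_inf A ^ (k - 1)"
      using kappa_ratio_le[OF k assms(2) w \<open>v \<noteq> 0\<close> \<open>w \<noteq> 0\<close> B] Q k by simp
    show "1 / (Z_const k * cond_inf A ^ (k - 1)) \<le> Q_theta_p A k B v"
      using lower[OF kappa_ratio_le[OF k \<open>invertible C\<close> v' \<open>w \<noteq> 0\<close> \<open>v \<noteq> 0\<close> B']] Q k by (simp add: cond)
  qed
qed

end
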